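(* There is an absolute constant $c_0>0$ such that the following holds. Let $\lambda=\lambda(d)\geq \frac{c_0\log d}{d^{1/3}}$ and let $I$ be chosen from $\mathcal{I}(Q_d)$ according to ${\rm hc}(\lambda)$. If $\lambda = 1+\omega(1/d)$ then $$\Pr\left(\min\{|I\cap\mathcal{E}|,|I\cap\mathcal{O}|\}=0\right)=1-o(1),$$ whereas if $\lambda = 1-\omega(1/d)$ then $$\Pr\left(\min\{|I\cap\mathcal{E}|,|I\cap\mathcal{O}|\}=0\right)=o(1),$$ as $d\to\infty$.
   Context: $Q_d$ is the discrete hypercube: the graph on vertex set $\{0,1\}^d$ in which two strings are adjacent iff they differ in exactly one coordinate. It is bipartite with classes $\mathcal{E}$ (strings with an even number of $1$'s) and $\mathcal{O}$ (strings with an odd number of $1$'s). $\mathcal{I}(Q_d)$ is the set of independent sets of $Q_d$ (including the empty set). For $\lambda>0$, the hard-core distribution ${\rm hc}(\lambda)$ on $\mathcal{I}(Q_d)$ chooses each $I$ with probability proportional to $\lambda^{|I|}$. The parameter $\lambda$ may vary with $d$. "$\lambda=1+\omega(1/d)$" means $d(\lambda-1)\to\infty$ and "$\lambda=1-\omega(1/d)$" means $d(1-\lambda)\to\infty$ as $d\to\infty$. Logarithms are to base $e$. *)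

theory Defs
  imports "HOL-Probability.Probability"
begin

definition cube_vertices :: "nat \<Rightarrow> bool list set" where
  "cube_vertices d = {x. length x = d}"

definition cube_adj :: "bool list \<Rightarrow> bool list \<Rightarrow> bool" where
  "cube_adj x y \<longleftrightarrow> length x = length y \<and> (\<exists>!i. i < length x \<and> x ! i \<noteq> y ! i)"

definition even_class :: "nat \<Rightarrow> bool list set" where
  "even_class d = {x \<in> cube_vertices d. even (count_list x True)}"

definition odd_class :: "nat \<Rightarrow> bool list set" where
  "odd_class d = {x \<in> cube_vertices d. odd (count_list x True)}"

definition indep_sets_cube :: "nat \<Rightarrow> bool list set set" where
  "indep_sets_cube d = {I. I \<subseteq> cube_vertices d \<and> (\<forall>x\<in>I. \<forall>y\<in>I. \<not> cube_adj x y)}"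

definition hc_partition :: "nat \<Rightarrow> real \<Rightarrow> real" where
  "hc_partition d l = (\<Sum>I\<in>indep_sets_cube d. l ^ card I)"

text \<open>The weights sum to 1, so that \<^term>\<open>embed_pmf\<close> is meaningful, as soon as the fugacity
  is positive; see \<open>pmf_hc\<close> below.\<close>

definition hc :: "nat \<Rightarrow> real \<Rightarrow> bool list set pmf" where
  "hc d l = embed_pmf (\<lambda>I. if I \<in> indep_sets_cube d then l ^ card I / hc_partition d l else 0)"

lemma finite_cube_vertices: "finite (cube_vertices d)"
  using finite_lists_length_eq[of "UNIV :: bool set" d] by (simp add: cube_vertices_def)

lemma finite_indep_sets_cube: "finite (indep_sets_cube d)"
  by (rule finite_subset[of _ "Pow (cube_vertices d)"])
     (auto simp: indep_sets_cube_def finite_cube_vertices)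

lemma hc_partition_pos:
  assumes "l > 0"
  shows "hc_partition d l > 0"
proof -
  have "{} \<in> indep_sets_cube d"
    by (simp add: indep_sets_cube_def)
  then show ?thesis
    unfolding hc_partition_def using assms finite_indep_sets_cube[of d]
    by (intro sum_pos) auto
qed

lemma pmf_hc:
  assumes "l > 0"
  shows "pmf (hc d l) I = (if I \<in> indep_sets_cube d then l ^ card I / hc_partition d l else 0)"
proof -
  let ?f = "\<lambda>I. if I \<in> indep_sets_cube d then l ^ card I / hc_partition d l else 0"
  have nonneg: "?f J \<ge> 0" for J
    using assms hc_partition_pos[OF assms, of d] by simp
  have "(\<integral>\<^sup>+ J. ennreal (?f J) \<partial>count_space UNIV) = (\<Sum>J\<in>indep_sets_cube d. ennreal (?f J))"
    by (rule nn_integral_count_space'[OF finite_indep_sets_cube]) auto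
  also have "\<dots> = ennreal (\<Sum>J\<in>indep_sets_cube d. ?f J)"
    by (rule sum_ennreal) (rule nonneg)
  also have "(\<Sum>J\<in>indep_sets_cube d. ?f J) = 1"
    using hc_partition_pos[OF assms, of d]
    by (simp add: sum_divide_distrib[symmetric] hc_partition_def[symmetric])
  finally show ?thesis
    unfolding hc_def by (intro pmf_embed_pmf nonneg) simp
qed

end

theory Submission
  imports Defs "HOL-Real_Asymp.Real_Asymp"
begin

text \<open>Write \<open>N = 2 ^ (d - 1)\<close> for the size of each class, \<open>Nb A\<close> for the neighbourhood of a set \<open>A\<close>
  of vertices of one class, and \<open>cl A\<close> for its closure, the largest set of the same class with
  neighbourhood \<open>Nb A\<close>. The independent sets that miss one class have total
  weight \<open>2 * (1 + \<lambda>) ^ N - 1\<close>, so the question is whether the partition function is much larger than \<open>(1 + \<lambda>) ^ N\<close>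
  because of sets that meet both. The cheapest such sets have a single vertex on one side; their
  weight relative to \<open>(1 + \<lambda>) ^ N\<close> is \<open>N * \<lambda> / (1 + \<lambda>) ^ d = (\<lambda> / 2) * (2 / (1 + \<lambda>)) ^ d\<close>, which tends to
  zero if \<open>d * (\<lambda> - 1)\<close> tends to infinity. If \<open>d * (1 - \<lambda>)\<close> tends to infinity, so does this
  weight, since \<open>\<lambda>\<close> is not too small. This settles the case
  \<open>\<lambda> < 1\<close> (\<open>prob_one_sided_le\<close>), and for \<open>\<lambda> > 1\<close> it remains to bound all other sets.

  Call a nonempty set \<open>A\<close> within one class a polymer if it is connected under having common
  neighbours and \<open>cl A\<close> has at most \<open>N / 2\<close> elements. An independent set that meets both classes has
  a polymer among its components on one side, and the probability that \<open>A\<close> is such a component is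
  at most its weight \<open>\<lambda> ^ card A / (1 + \<lambda>) ^ card (Nb A)\<close> (\<open>two_sided_weight_le\<close>). So it suffices
  that the polymers with two or more vertices have total weight \<open>o(1)\<close>, for \<open>\<lambda> \<ge> 1\<close>
  (\<open>polymer_sum_le\<close>). Up to size \<open>d powr (8/5)\<close> this follows from a crude count of connected sets,
  because two vertices have at most two common neighbours and therefore small sets expand strongly
  (\<open>expansion_from_codegree\<close>).

  For larger polymers the number of sets is controlled by a form of Sapozhenko's method of
  approximations (\<open>approximation\<close>, \<open>container_sum\<close>). Put \<open>t = card (Nb A) - card (cl A)\<close>; exactly
  \<open>d * t\<close> edges leave \<open>cl A \<union> Nb A\<close>. A set \<open>T \<subseteq> cl A\<close> with much fewer than \<open>t\<close> elements, itself
  connected at distance six, encodes a set \<open>F \<subseteq> Nb A\<close> and a set \<open>S \<supseteq> cl A\<close> with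
  \<open>card S \<le> card F + o(t)\<close>. Either \<open>S\<close> is noticeably smaller than \<open>Nb A\<close>, and summing over all
  subsets of \<open>S\<close> is affordable, or \<open>F\<close> is almost all of \<open>Nb A\<close>, and the rest of \<open>Nb A\<close> can be listed
  at small cost; then \<open>cl A\<close> is known and the sum over its subsets gains \<open>(1 + \<lambda>) powr (- t)\<close>. That \<open>T\<close>
  can be so small depends on \<open>t\<close> being at least of order \<open>card (cl A) / sqrt d\<close>
  (\<open>parity_isoperimetry\<close>), a consequence of a one-sided functional inequality on the cube
  (\<open>one_sided_bobkov\<close>) that is proved by induction on the dimension.\<close>

section \<open>Linked sets\<close>

text \<open>A set is \<open>r\<close>-linked if it is connected in the graph of the relation \<open>r\<close>. This is
  expressed by cuts: from every proper nonempty part some \<open>r\<close>-edge leads to the rest. The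
  empty set counts as linked.\<close>
definition linked :: "('a \<Rightarrow> 'a \<Rightarrow> bool) \<Rightarrow> 'a set \<Rightarrow> bool" where
  "linked r A \<longleftrightarrow> (\<forall>B\<subseteq>A. B \<noteq> {} \<longrightarrow> B \<noteq> A \<longrightarrow> (\<exists>b\<in>B. \<exists>c\<in>A - B. r b c))"

lemma linkedE:
  assumes "linked r A" "B \<subseteq> A" "B \<noteq> {}" "B \<noteq> A"
  obtains b c where "b \<in> B" "c \<in> A - B" "r b c"
  using assms unfolding linked_def by blast

text \<open>A connected component is a smallest nonempty subset of \<open>X\<close> that no \<open>r\<close>-edge leaves.\<close>
lemma linked_component_exists:
  assumes "finite X" "X \<noteq> {}" "\<And>x y. x \<in> X \<Longrightarrow> y \<in> X \<Longrightarrow> r x y \<Longrightarrow> r y x"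
  obtains C where "C \<subseteq> X" "C \<noteq> {}" "linked r C" "\<And>x y. x \<in> C \<Longrightarrow> y \<in> X - C \<Longrightarrow> \<not> r x y"
proof -
  define P where "P C \<longleftrightarrow> C \<subseteq> X \<and> C \<noteq> {} \<and> (\<forall>x\<in>C. \<forall>y\<in>X - C. \<not> r x y)" for C
  have "P X" using assms by (auto simp: P_def)
  then obtain C where C: "P C" and min: "\<And>B. P B \<Longrightarrow> card C \<le> card B"
    using ex_has_least_nat[of P X card] by blast
  have "linked r C"
    unfolding linked_def
  proof (intro allI impI, rule ccontr)
    fix B assume B: "B \<subseteq> C" "B \<noteq> {}" "B \<noteq> C" and no: "\<not> (\<exists>b\<in>B. \<exists>c\<in>C - B. r b c)"
    have "P B" unfolding P_def using B no C unfolding P_def by blast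
    then have "card C \<le> card B" by (rule min)
    moreover have "finite C" using C assms(1) by (auto simp: P_def intro: finite_subset)
    ultimately show False using B psubset_card_mono[of C B] by auto
  qed
  with C show ?thesis using that by (auto simp: P_def)
qed

text \<open>A linked set is the vertex set of a walk: each new vertex \<open>c\<close> adjacent to a visited vertex \<open>b\<close>
  is inserted as a detour \<open>b, c, b\<close>, which makes the walk two steps longer.\<close>
lemma linked_walk:
  assumes "finite A" "linked r A" "x \<in> A"
    and sym: "\<And>x y. x \<in> A \<Longrightarrow> y \<in> A \<Longrightarrow> r x y \<Longrightarrow> r y x"
  shows "\<exists>xs. xs \<noteq> [] \<and> hd xs = x \<and> set xs = A \<and> length xs = 2 * card A - 1 \<and> successively r xs"
proof -
  have step: "\<exists>xs. xs \<noteq> [] \<and> hd xs = x \<and> set xs \<subseteq> A \<and> card (set xs) = Suc k \<and>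
      length xs = 2 * k + 1 \<and> successively r xs" if "k < card A" for k
    using that
  proof (induction k)
    case 0
    show ?case by (rule exI[of _ "[x]"]) (use assms in auto)
  next
    case (Suc k)
    then obtain xs where xs: "xs \<noteq> []" "hd xs = x" "set xs \<subseteq> A" "card (set xs) = Suc k"
      "length xs = 2 * k + 1" "successively r xs" by auto
    have "set xs \<noteq> A" using xs Suc.prems by auto
    then obtain b c where bc: "b \<in> set xs" "c \<in> A - set xs" "r b c"
      using linkedE[OF assms(2) xs(3)] xs(1) by (metis set_empty)
    obtain ys zs where yz: "xs = ys @ b # zs" using bc(1) by (meson split_list)
    have cb: "r c b" using bc sym xs(3) by blast
    let ?w = "ys @ b # c # b # zs"
    have "successively r ?w"
      using xs(6) bc(3) cb unfolding yz by (auto simp: successively_append_iff successively_Cons)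
    moreover have "set ?w = insert c (set xs)" by (auto simp: yz)
    moreover have "hd ?w = x" using xs(2) by (cases ys) (auto simp: yz)
    ultimately show ?case
      using xs bc by (intro exI[of _ ?w]) (auto simp: yz)
  qed
  have "card A > 0" using assms by (auto simp: card_gt_0_iff)
  then obtain xs where xs: "xs \<noteq> []" "hd xs = x" "set xs \<subseteq> A" "card (set xs) = Suc (card A - 1)"
      "length xs = 2 * (card A - 1) + 1" "successively r xs"
    using step[of "card A - 1"] by auto
  moreover have "set xs = A"
    using xs \<open>card A > 0\<close> assms(1) by (intro card_subset_eq) auto
  ultimately show ?thesis using \<open>card A > 0\<close> by (intro exI[of _ xs]) auto
qed

lemma card_walks_le:
  assumes "finite V" "\<And>x. x \<in> V \<Longrightarrow> card {y \<in> V. r x y} \<le> D" "x \<in> V"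
  shows "finite {xs. length xs = Suc n \<and> hd xs = x \<and> set xs \<subseteq> V \<and> successively r xs} \<and>
    card {xs. length xs = Suc n \<and> hd xs = x \<and> set xs \<subseteq> V \<and> successively r xs} \<le> D ^ n"
  using assms(3)
proof (induction n arbitrary: x)
  case 0
  have "{xs. length xs = Suc 0 \<and> hd xs = x \<and> set xs \<subseteq> V \<and> successively r xs} = {[x]}"
    using 0 by (auto simp: length_Suc_conv)
  then show ?case by simp
next
  case (Suc n)
  let ?W = "\<lambda>n x. {xs. length xs = Suc n \<and> hd xs = x \<and> set xs \<subseteq> V \<and> successively r xs}"
  let ?N = "{y \<in> V. r x y}"
  have sub: "?W (Suc n) x \<subseteq> (#) x ` (\<Union>y\<in>?N. ?W n y)"
    by (auto simp: length_Suc_conv)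
  have fin: "finite (\<Union>y\<in>?N. ?W n y)" using Suc.IH assms(1) by auto
  have "card (?W (Suc n) x) \<le> card ((#) x ` (\<Union>y\<in>?N. ?W n y))"
    using sub fin by (intro card_mono) auto
  also have "\<dots> \<le> card (\<Union>y\<in>?N. ?W n y)" by (rule card_image_le[OF fin])
  also have "\<dots> \<le> (\<Sum>y\<in>?N. card (?W n y))" using assms(1) by (intro card_UN_le) auto
  also have "\<dots> \<le> of_nat (card ?N) * D ^ n" using Suc.IH by (intro sum_bounded_above) auto
  also have "\<dots> \<le> D * D ^ n" using assms(2) Suc.prems by simp
  finally show ?case using finite_subset[OF sub] fin by auto
qed

text \<open>In a graph of maximum degree \<open>D\<close> there are few linked sets: each is the range of a walk of
  length exactly \<open>2 * m - 1\<close>, because \<open>r\<close> is reflexive and a shorter walk can wait at its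
  start.\<close>
lemma card_linked_sets_containing_le:
  assumes "finite V" "\<And>x. x \<in> V \<Longrightarrow> card {y \<in> V. r x y} \<le> D" "x \<in> V"
    and sym: "\<And>x y. x \<in> V \<Longrightarrow> y \<in> V \<Longrightarrow> r x y \<Longrightarrow> r y x" and refl: "\<And>x. x \<in> V \<Longrightarrow> r x x"
    and "m > 0"
  shows "card {A. A \<subseteq> V \<and> x \<in> A \<and> linked r A \<and> card A \<le> m} \<le> D ^ (2 * (m - 1))"
proof -
  let ?W = "{xs. length xs = Suc (2 * (m - 1)) \<and> hd xs = x \<and> set xs \<subseteq> V \<and> successively r xs}"
  note W = card_walks_le[of V r D x "2 * (m - 1)", OF assms(1,2,3)]
  have "{A. A \<subseteq> V \<and> x \<in> A \<and> linked r A \<and> card A \<le> m} \<subseteq> set ` ?W"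
  proof
    fix A assume "A \<in> {A. A \<subseteq> V \<and> x \<in> A \<and> linked r A \<and> card A \<le> m}"
    then have A: "A \<subseteq> V" "x \<in> A" "linked r A" "card A \<le> m" by auto
    have "finite A" using A assms(1) finite_subset by blast
    then have "card A > 0" using A by (auto simp: card_gt_0_iff)
    have symA: "r z y" if "y \<in> A" "z \<in> A" "r y z" for y z
      using sym[of y z] that A(1) by auto
    have "\<exists>xs. xs \<noteq> [] \<and> hd xs = x \<and> set xs = A \<and> length xs = 2 * card A - 1 \<and> successively r xs"
      by (rule linked_walk[OF \<open>finite A\<close> A(3,2)]) (rule symA)
    then obtain xs where xs: "xs \<noteq> []" "hd xs = x" "set xs = A" "length xs = 2 * card A - 1" "successively r xs"
      by blast
    define k where "k = Suc (2 * (m - 1)) - length xs"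
    have hd: "hd (replicate j x @ xs) = x" for j
      using xs(2) by (induction j) simp_all
    have "successively r (replicate j x @ xs)" for j
    proof (induction j)
      case 0
      show ?case using xs(5) by simp
    next
      case (Suc j)
      show ?case
        using Suc hd[of j] refl[OF assms(3)] by (simp add: successively_Cons)
    qed
    moreover note hd[of k]
    moreover have "length (replicate k x @ xs) = Suc (2 * (m - 1))"
      using A(4) \<open>card A > 0\<close> xs(4) by (auto simp: k_def)
    moreover have "set (replicate k x @ xs) = A" using xs(3) A(2) by auto
    ultimately show "A \<in> set ` ?W" using A(1) by (intro image_eqI[of _ _ "replicate k x @ xs"]) auto
  qed
  then have "card {A. A \<subseteq> V \<and> x \<in> A \<and> linked r A \<and> card A \<le> m} \<le> card (set ` ?W)"
    using W by (intro card_mono) auto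
  also have "\<dots> \<le> card ?W" using W by (intro card_image_le) auto
  also have "\<dots> \<le> D ^ (2 * (m - 1))" using W by auto
  finally show ?thesis .
qed

lemma card_linked_sets_le:
  assumes "finite V" "\<And>x. x \<in> V \<Longrightarrow> card {y \<in> V. r x y} \<le> D"
    and sym: "\<And>x y. x \<in> V \<Longrightarrow> y \<in> V \<Longrightarrow> r x y \<Longrightarrow> r y x" and refl: "\<And>x. x \<in> V \<Longrightarrow> r x x"
    and "m > 0"
  shows "card {A. A \<subseteq> V \<and> A \<noteq> {} \<and> linked r A \<and> card A \<le> m} \<le> card V * D ^ (2 * (m - 1))"
proof -
  let ?F = "\<lambda>x. {A. A \<subseteq> V \<and> x \<in> A \<and> linked r A \<and> card A \<le> m}"
  have "card {A. A \<subseteq> V \<and> A \<noteq> {} \<and> linked r A \<and> card A \<le> m} \<le> card (\<Union>x\<in>V. ?F x)"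
    by (intro card_mono finite_subset[of "(\<Union>x\<in>V. ?F x)" "Pow V"]) (use assms(1) in auto)
  also have "\<dots> \<le> (\<Sum>x\<in>V. card (?F x))" using assms(1) by (rule card_UN_le)
  also have "\<dots> \<le> of_nat (card V) * D ^ (2 * (m - 1))"
  proof (rule sum_bounded_above)
    fix x assume "x \<in> V"
    show "card (?F x) \<le> D ^ (2 * (m - 1))"
      by (rule card_linked_sets_containing_le[OF assms(1) _ \<open>x \<in> V\<close> _ _ \<open>m > 0\<close>];
          fact assms(2) sym refl)
  qed
  finally show ?thesis by simp
qed

section \<open>Regular bipartite graphs\<close>

lemma double_count_edges:
  assumes "finite X" "finite Y" "\<And>u v. u \<in> X \<Longrightarrow> v \<in> Y \<Longrightarrow> v \<in> f u \<longleftrightarrow> u \<in> g v"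
  shows "(\<Sum>u\<in>X. card (f u \<inter> Y)) = (\<Sum>v\<in>Y. card (g v \<inter> X))"
proof -
  have "(\<Sum>u\<in>X. card (f u \<inter> Y)) = (\<Sum>u\<in>X. \<Sum>v\<in>Y. if v \<in> f u then 1 else 0)"
    using assms(2) by (intro sum.cong refl) (simp add: sum.If_cases Int_commute[of Y] Collect_mem_eq)
  also have "\<dots> = (\<Sum>v\<in>Y. \<Sum>u\<in>X. if v \<in> f u then 1 else 0)"
    by (rule sum.swap)
  also have "\<dots> = (\<Sum>v\<in>Y. \<Sum>u\<in>X. if u \<in> g v then 1 else 0)"
    using assms by (intro sum.cong refl) auto
  also have "\<dots> = (\<Sum>v\<in>Y. card (g v \<inter> X))"
    using assms(1) by (intro sum.cong refl) (simp add: sum.If_cases Int_commute[of X] Collect_mem_eq)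
  finally show ?thesis .
qed

lemma sum_Pow_power_card:
  fixes x :: "'b::comm_semiring_1"
  assumes "finite A"
  shows "(\<Sum>B\<in>Pow A. x ^ card B) = (1 + x) ^ card A"
  using prod_add[OF assms, of "\<lambda>_. x" "\<lambda>_. 1"] by (simp add: add.commute)

text \<open>A \<open>d\<close>-regular bipartite graph with finite classes \<open>L\<close> and \<open>R\<close>. One function \<open>nb\<close> gives
  the neighbourhoods of the vertices of both classes, so that exchanging \<open>L\<close> and \<open>R\<close> yields
  another instance.\<close>
locale bireg =
  fixes L R :: "'a set" and nb :: "'a \<Rightarrow> 'a set" and d :: nat
  assumes finite_L: "finite L" and finite_R: "finite R" and disjoint_LR: "L \<inter> R = {}"
    and d_pos: "d > 0"
    and nb_L: "u \<in> L \<Longrightarrow> nb u \<subseteq> R" and nb_R: "v \<in> R \<Longrightarrow> nb v \<subseteq> L"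
    and nb_sym: "u \<in> L \<Longrightarrow> v \<in> R \<Longrightarrow> v \<in> nb u \<longleftrightarrow> u \<in> nb v"
    and deg_L: "u \<in> L \<Longrightarrow> card (nb u) = d" and deg_R: "v \<in> R \<Longrightarrow> card (nb v) = d"
begin

text \<open>\<open>Nb A\<close> is the neighbourhood of a set. The closure \<open>cl A\<close> of \<open>A \<subseteq> L\<close> is the largest subset
  of \<open>L\<close> with the same neighbourhood. Two vertices are \<open>near\<close> if they have a common neighbour;
  a vertex of \<open>L\<close> is near itself.\<close>
definition Nb :: "'a set \<Rightarrow> 'a set" where "Nb A = (\<Union>u\<in>A. nb u)"

definition cl :: "'a set \<Rightarrow> 'a set" where "cl A = {u \<in> L. nb u \<subseteq> Nb A}"

definition near :: "'a \<Rightarrow> 'a \<Rightarrow> bool" where "near u u' \<longleftrightarrow> nb u \<inter> nb u' \<noteq> {}"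

lemma swap: "bireg R L nb d"
proof
  show "R \<inter> L = {}" using disjoint_LR by blast
  show "v \<in> nb u \<longleftrightarrow> u \<in> nb v" if "u \<in> R" "v \<in> L" for u v
    using nb_sym[OF that(2,1)] by simp
qed (fact finite_L finite_R d_pos nb_L nb_R deg_L deg_R)+

lemma Nb_subset: "A \<subseteq> L \<Longrightarrow> Nb A \<subseteq> R"
  unfolding Nb_def using nb_L by blast

lemma finite_subset_L: "A \<subseteq> L \<Longrightarrow> finite A"
  by (rule finite_subset[OF _ finite_L])

lemma finite_Nb: "A \<subseteq> L \<Longrightarrow> finite (Nb A)"
  by (rule finite_subset[OF Nb_subset finite_R])

lemma finite_nb: "u \<in> L \<Longrightarrow> finite (nb u)" "v \<in> R \<Longrightarrow> finite (nb v)"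
  by (rule finite_subset[OF nb_L finite_R], assumption) (rule finite_subset[OF nb_R finite_L])

lemma Nb_mono: "A \<subseteq> B \<Longrightarrow> Nb A \<subseteq> Nb B"
  unfolding Nb_def by blast

lemma cl_subset: "cl A \<subseteq> L"
  unfolding cl_def by blast

lemma subset_cl: "A \<subseteq> L \<Longrightarrow> A \<subseteq> cl A"
  unfolding cl_def Nb_def by blast

lemma Nb_cl: "A \<subseteq> L \<Longrightarrow> Nb (cl A) = Nb A"
  by (rule equalityI[OF _ Nb_mono[OF subset_cl]]) (auto simp: cl_def Nb_def)

lemma edges_count:
  assumes "X \<subseteq> L" "Y \<subseteq> R"
  shows "(\<Sum>u\<in>X. card (nb u \<inter> Y)) = (\<Sum>v\<in>Y. card (nb v \<inter> X))"
proof (rule double_count_edges)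
  show "finite X" "finite Y" using assms finite_L finite_R by (auto intro: finite_subset)
  show "v \<in> nb u \<longleftrightarrow> u \<in> nb v" if "u \<in> X" "v \<in> Y" for u v
    by (rule nb_sym) (use that assms in auto)
qed

lemma edges_into_Nb:
  assumes "X \<subseteq> L" "Nb X \<subseteq> Y" "Y \<subseteq> R"
  shows "(\<Sum>v\<in>Y. card (nb v \<inter> X)) = d * card X"
proof -
  have "(\<Sum>v\<in>Y. card (nb v \<inter> X)) = (\<Sum>u\<in>X. card (nb u \<inter> Y))"
    using edges_count[OF assms(1,3)] by simp
  also have "\<dots> = (\<Sum>u\<in>X. d)"
  proof (intro sum.cong refl)
    fix u assume "u \<in> X"
    then have "nb u \<inter> Y = nb u" "u \<in> L" using assms by (auto simp: Nb_def)
    then show "card (nb u \<inter> Y) = d" using deg_L by simp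
  qed
  finally show ?thesis by simp
qed

lemma card_Nb_ge: assumes "A \<subseteq> L" shows "card A \<le> card (Nb A)"
proof -
  have "d * card A = (\<Sum>v\<in>Nb A. card (nb v \<inter> A))"
    using edges_into_Nb[OF assms order_refl Nb_subset[OF assms]] by simp
  also have "\<dots> \<le> (\<Sum>v\<in>Nb A. d)"
    using Nb_subset[OF assms] deg_R finite_nb by (intro sum_mono) (metis card_mono inf_le1 subsetD)
  finally show ?thesis using d_pos by simp
qed

lemma card_L_eq_card_R: "card L = card R"
proof -
  interpret S: bireg R L nb d by (rule swap)
  have "card L \<le> card (Nb L)" by (rule card_Nb_ge) simp
  also have "\<dots> \<le> card R" by (intro card_mono finite_R Nb_subset) simp
  finally have "card L \<le> card R" .
  moreover have "card R \<le> card (S.Nb R)" by (rule S.card_Nb_ge) simp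
  moreover have "card (S.Nb R) \<le> card L" by (intro card_mono finite_L S.Nb_subset) simp
  ultimately show ?thesis by simp
qed

text \<open>The difference \<open>card (Nb C) - card C\<close> measures, up to the factor \<open>d\<close>, the number of edges
  that leave \<open>C \<union> Nb C\<close>. The approximation below is built on this identity.\<close>
lemma edges_out_of_Nb:
  assumes "C \<subseteq> L"
  shows "(\<Sum>v\<in>Nb C. card (nb v \<inter> (L - C))) = d * (card (Nb C) - card C)"
proof -
  have "(\<Sum>v\<in>Nb C. card (nb v \<inter> (L - C))) + (\<Sum>v\<in>Nb C. card (nb v \<inter> C)) = (\<Sum>v\<in>Nb C. d)"
    unfolding sum.distrib[symmetric]
  proof (intro sum.cong refl)
    fix v assume "v \<in> Nb C"
    then have v: "v \<in> R" using Nb_subset[OF assms] by auto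
    have "card (nb v \<inter> (L - C)) + card (nb v \<inter> C) = card ((nb v \<inter> (L - C)) \<union> (nb v \<inter> C))"
      using finite_nb(2)[OF v] by (intro card_Un_disjoint[symmetric]) auto
    also have "(nb v \<inter> (L - C)) \<union> (nb v \<inter> C) = nb v" using nb_R[OF v] by auto
    finally show "card (nb v \<inter> (L - C)) + card (nb v \<inter> C) = d" using deg_R[OF v] by simp
  qed
  moreover have "(\<Sum>v\<in>Nb C. card (nb v \<inter> C)) = d * card C"
    by (rule edges_into_Nb) (use assms Nb_subset in auto)
  ultimately show ?thesis by (simp add: diff_mult_distrib2 mult.commute)
qed

lemma near_sym: "near x y \<Longrightarrow> near y x"
  unfolding near_def by (simp add: Int_commute)

lemma near_refl: "x \<in> L \<Longrightarrow> near x x"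
  unfolding near_def using deg_L[of x] d_pos by (auto simp: card_gt_0_iff)

lemma card_near_le: assumes "x \<in> L" shows "card {y \<in> L. near x y} \<le> d ^ 2"
proof -
  have "{y \<in> L. near x y} \<subseteq> (\<Union>v\<in>nb x. nb v)"
    using assms nb_sym nb_L unfolding near_def by blast
  then have "card {y \<in> L. near x y} \<le> card (\<Union>v\<in>nb x. nb v)"
  proof (intro card_mono finite_UN_I finite_nb(1)[OF assms])
    show "finite (nb v)" if "v \<in> nb x" for v using finite_nb(2) nb_L[OF assms] that by blast
  qed
  also have "\<dots> \<le> (\<Sum>v\<in>nb x. card (nb v))" using finite_nb(1)[OF assms] by (intro card_UN_le)
  also have "\<dots> = (\<Sum>v\<in>nb x. d)" using nb_L[OF assms] by (intro sum.cong refl deg_R) auto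
  finally show ?thesis using deg_L[OF assms] by (simp add: power2_eq_square)
qed

text \<open>Three steps of \<open>near\<close>, that is, distance at most six in the graph.\<close>
definition near3 :: "'a \<Rightarrow> 'a \<Rightarrow> bool" where
  "near3 x y \<longleftrightarrow> (\<exists>u\<in>L. \<exists>w\<in>L. near x u \<and> near u w \<and> near w y)"

lemma near3_sym: "near3 x y \<Longrightarrow> near3 y x"
  unfolding near3_def using near_sym by blast

lemma near3_refl: "x \<in> L \<Longrightarrow> near3 x x"
  unfolding near3_def using near_refl by blast

lemma card_near3_le: assumes "x \<in> L" shows "card {y \<in> L. near3 x y} \<le> d ^ 6"
proof -
  let ?n = "\<lambda>x. {y \<in> L. near x y}"
  have fin: "finite (?n x)" for x using finite_L by simp
  have two: "card (\<Union>u\<in>?n z. ?n u) \<le> d ^ 4" if "z \<in> L" for z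
  proof -
    have "card (\<Union>u\<in>?n z. ?n u) \<le> (\<Sum>u\<in>?n z. card (?n u))" by (rule card_UN_le[OF fin])
    also have "\<dots> \<le> of_nat (card (?n z)) * d ^ 2" by (intro sum_bounded_above card_near_le) auto
    also have "\<dots> \<le> d ^ 2 * d ^ 2" unfolding of_nat_id by (intro mult_right_mono card_near_le that) simp
    finally show ?thesis by (simp flip: power_add)
  qed
  have "{y \<in> L. near3 x y} = (\<Union>u\<in>?n x. \<Union>w\<in>?n u. ?n w)"
    unfolding near3_def by blast
  then have "card {y \<in> L. near3 x y} \<le> (\<Sum>u\<in>?n x. card (\<Union>w\<in>?n u. ?n w))"
    by (simp only: card_UN_le[OF fin])
  also have "\<dots> \<le> of_nat (card (?n x)) * d ^ 4" by (intro sum_bounded_above two) auto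
  also have "\<dots> \<le> d ^ 2 * d ^ 4" unfolding of_nat_id by (intro mult_right_mono card_near_le assms) simp
  finally show ?thesis by (simp flip: power_add)
qed

lemma linked_cl:
  assumes "A \<subseteq> L" "linked near A"
  shows "linked near (cl A)"
  unfolding linked_def
proof (intro allI impI)
  fix B assume B: "B \<subseteq> cl A" "B \<noteq> {}" "B \<noteq> cl A"
  have nbhd: "\<exists>u\<in>A. near b u" if "b \<in> cl A" for b
  proof -
    have "b \<in> L" "nb b \<subseteq> Nb A" using that by (auto simp: cl_def)
    moreover obtain v where "v \<in> nb b" using deg_L[OF \<open>b \<in> L\<close>] d_pos by (auto simp: card_gt_0_iff)
    ultimately obtain u where "u \<in> A" "v \<in> nb u" by (auto simp: Nb_def)
    then show ?thesis using \<open>v \<in> nb b\<close> by (auto simp: near_def)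
  qed
  consider "A \<inter> B = {}" | "A \<subseteq> B" | "A \<inter> B \<noteq> {}" "A \<inter> B \<noteq> A" by blast
  then show "\<exists>b\<in>B. \<exists>c\<in>cl A - B. near b c"
  proof cases
    case 1
    obtain b where "b \<in> B" using B by auto
    then obtain u where "u \<in> A" "near b u" using nbhd B by blast
    then show ?thesis using \<open>b \<in> B\<close> 1 subset_cl[OF assms(1)] by blast
  next
    case 2
    obtain c where c: "c \<in> cl A - B" using B by auto
    then obtain u where "u \<in> A" "near c u" using nbhd by blast
    then show ?thesis using c 2 near_sym by blast
  next
    case 3
    then obtain b c where "b \<in> A \<inter> B" "c \<in> A - (A \<inter> B)" "near b c"
      using linkedE[OF assms(2), of "A \<inter> B"] by blast
    then show ?thesis using subset_cl[OF assms(1)] by blast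
  qed
qed

text \<open>A subset \<open>T\<close> to which every vertex of a linked set is near is itself linked for the coarser
  relation \<open>near3\<close>.\<close>
lemma linked_near3_dense:
  assumes "C \<subseteq> L" "linked near C" "T \<subseteq> C" "\<And>u. u \<in> C \<Longrightarrow> \<exists>t\<in>T. near u t"
  shows "linked near3 T"
  unfolding linked_def
proof (intro allI impI)
  fix B assume B: "B \<subseteq> T" "B \<noteq> {}" "B \<noteq> T"
  define B1 where "B1 = {u \<in> C. \<exists>t\<in>B. near u t}"
  define B2 where "B2 = {u \<in> C. \<exists>t\<in>T - B. near u t}"
  have cov: "B1 \<union> B2 = C" using assms(4) by (auto simp: B1_def B2_def)
  have TL: "T \<subseteq> L" using assms by auto
  have sub: "B \<subseteq> B1" "T - B \<subseteq> B2"
    using B(1) assms(3) TL near_refl unfolding B1_def B2_def by blast+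
  show "\<exists>b\<in>B. \<exists>c\<in>T - B. near3 b c"
  proof (cases "B1 = C")
    case True
    obtain c where c: "c \<in> T - B" using B by auto
    then have "c \<in> B1" using True assms(3) by auto
    then obtain t where t: "t \<in> B" "near c t" by (auto simp: B1_def)
    then have "near3 t c"
      unfolding near3_def using c TL B(1) near_refl near_sym by blast
    then show ?thesis using t c by blast
  next
    case False
    moreover have "B1 \<noteq> {}" "B1 \<subseteq> C" using sub B by (auto simp: B1_def)
    ultimately obtain u w where uw: "u \<in> B1" "w \<in> C - B1" "near u w"
      using linkedE[OF assms(2)] by metis
    then have "w \<in> B2" using cov by auto
    then obtain t t' where t: "t \<in> B" "near u t" "t' \<in> T - B" "near w t'"
      using uw by (auto simp: B1_def B2_def)
    then have "near3 t t'"
      unfolding near3_def using uw assms(1) near_sym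
      by (intro bexI[of _ u] bexI[of _ w]) (auto simp: B1_def)
    then show ?thesis using t by blast
  qed
qed

end

section \<open>Approximation of closed sets\<close>

lemma sum_UN_le:
  fixes f :: "'b \<Rightarrow> real"
  assumes "finite I" "\<And>i. i \<in> I \<Longrightarrow> finite (A i)" "\<And>x. f x \<ge> 0"
  shows "sum f (\<Union>i\<in>I. A i) \<le> (\<Sum>i\<in>I. sum f (A i))"
  using assms(1,2)
proof (induction I rule: finite_induct)
  case (insert i I)
  have "sum f (\<Union>j\<in>insert i I. A j) = sum f (A i \<union> (\<Union>j\<in>I. A j))" by simp
  also have "\<dots> \<le> sum f (A i) + sum f (\<Union>j\<in>I. A j)"
    using insert.prems insert.hyps sum.union_inter[of "A i" "\<Union>j\<in>I. A j" f] sum_nonneg[of "A i \<inter> (\<Union>j\<in>I. A j)" f] assms(3)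
    by simp
  finally show ?case using insert by auto
qed simp

text \<open>The bound is \<open>(1 + y) ^ card Y = (\<Sum>U\<in>Pow Y. y ^ card U)\<close> restricted to the small sets
  \<open>U\<close>.\<close>
lemma card_small_subsets_le:
  fixes y r :: real
  assumes "finite Y" "0 < y" "y \<le> 1"
  shows "real (card {U. U \<subseteq> Y \<and> real (card U) \<le> r}) \<le> exp (y * card Y) * y powr (- r)"
proof -
  let ?F = "{U. U \<subseteq> Y \<and> real (card U) \<le> r}"
  have "real (card ?F) * y powr r = (\<Sum>U\<in>?F. y powr r)" by simp
  also have "\<dots> \<le> (\<Sum>U\<in>?F. y ^ card U)"
    using assms by (intro sum_mono) (auto simp flip: powr_realpow intro!: powr_mono')
  also have "\<dots> \<le> (\<Sum>U\<in>Pow Y. y ^ card U)"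
    using assms by (intro sum_mono2) auto
  also have "\<dots> = (1 + y) ^ card Y" by (rule sum_Pow_power_card[OF assms(1)])
  also have "\<dots> \<le> exp y ^ card Y" using assms by (intro power_mono exp_ge_add_one_self) auto
  also have "\<dots> = exp (y * card Y)" by (metis exp_of_nat_mult mult.commute)
  finally show ?thesis using assms by (simp add: powr_minus field_simps)
qed

context bireg
begin

lemma card_Nb_le: assumes "A \<subseteq> L" shows "card (Nb A) \<le> d * card A"
proof -
  have "card (Nb A) \<le> (\<Sum>u\<in>A. card (nb u))" unfolding Nb_def
    by (rule card_UN_le[OF finite_subset_L[OF assms]])
  also have "\<dots> = (\<Sum>u\<in>A. d)" using assms by (intro sum.cong refl deg_L) auto
  finally show ?thesis by (simp add: mult.commute)
qed

text \<open>Some vertex of \<open>C\<close> is adjacent to a fraction \<open>\<phi> / card C\<close> of the vertices of \<open>H\<close> that are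
  not yet covered, by averaging; \<open>T\<close> collects \<open>k\<close> such vertices.\<close>
lemma greedy_cover:
  assumes "C \<subseteq> L" "H \<subseteq> R" "0 < \<phi>" "\<And>v. v \<in> H \<Longrightarrow> \<phi> \<le> real (card (nb v \<inter> C))" "H \<noteq> {}"
  shows "\<exists>T\<subseteq>C. card T \<le> k \<and> real (card (H - Nb T)) \<le> real (card H) * (1 - \<phi> / card C) ^ k"
proof (induction k)
  case 0
  show ?case by (intro exI[of _ "{}"]) (simp add: Nb_def)
next
  case (Suc k)
  then obtain T where T: "T \<subseteq> C" "card T \<le> k"
    "real (card (H - Nb T)) \<le> real (card H) * (1 - \<phi> / card C) ^ k" by blast
  have finC: "finite C" by (rule finite_subset_L[OF assms(1)])
  have finH: "finite H" using assms(2) finite_R finite_subset by blast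
  obtain v where "v \<in> H" using assms(5) by auto
  have "\<phi> \<le> card (nb v \<inter> C)" by (rule assms(4)[OF \<open>v \<in> H\<close>])
  also have "\<dots> \<le> card C" using finC by (simp add: card_mono)
  finally have phiC: "\<phi> \<le> card C" .
  then have Cpos: "card C > 0" using assms(3) by linarith
  let ?H = "H - Nb T"
  have HR: "?H \<subseteq> R" using assms(2) by auto
  have "\<exists>u\<in>C. \<phi> * card ?H / card C \<le> card (nb u \<inter> ?H)"
  proof (rule ccontr)
    assume neg: "\<not> ?thesis"
    have "(\<Sum>u\<in>C. real (card (nb u \<inter> ?H))) < (\<Sum>u\<in>C. \<phi> * card ?H / card C)"
      using neg finC Cpos by (intro sum_strict_mono) (auto simp: not_le)
    also have "\<dots> = (\<Sum>v\<in>?H. \<phi>)" using Cpos by simp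
    also have "\<dots> \<le> (\<Sum>v\<in>?H. real (card (nb v \<inter> C)))" using assms(4) by (intro sum_mono) auto
    also have "\<dots> = real (\<Sum>v\<in>?H. card (nb v \<inter> C))" by simp
    also have "\<dots> = real (\<Sum>u\<in>C. card (nb u \<inter> ?H))"
      by (simp only: edges_count[OF assms(1) HR])
    finally show False by simp
  qed
  then obtain u where u: "u \<in> C" "\<phi> * card ?H / card C \<le> card (nb u \<inter> ?H)" by blast
  have "card ?H = card (?H \<inter> nb u) + card (?H - nb u)"
    using finH by (subst card_Un_disjoint[symmetric]) (auto intro!: arg_cong[where f = card])
  moreover have "H - Nb (insert u T) = ?H - nb u" by (auto simp: Nb_def)
  ultimately have "real (card (H - Nb (insert u T))) = card ?H - real (card (nb u \<inter> ?H))"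
    by (simp add: Int_commute)
  also have "\<dots> \<le> card ?H * (1 - \<phi> / card C)" using u(2) by (simp add: algebra_simps)
  also have "\<dots> \<le> real (card H) * (1 - \<phi> / card C) ^ k * (1 - \<phi> / card C)"
    using T(3) phiC Cpos by (intro mult_right_mono) (auto simp: field_simps)
  finally show ?case
    using T u(1) finite_subset[OF T(1) finC]
    by (intro exI[of _ "insert u T"]) (auto simp: card_insert_if mult_ac)
qed

text \<open>The greedy choice is stopped after about \<open>card C * ln d / \<phi>\<close> steps, when at most
  \<open>card H / d\<close> vertices are uncovered; each of these receives a neighbour of its own.\<close>
lemma covering_subset:
  assumes "C \<subseteq> L" "H \<subseteq> R" "0 < \<phi>" "\<And>v. v \<in> H \<Longrightarrow> \<phi> \<le> real (card (nb v \<inter> C))"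
  shows "\<exists>T\<subseteq>C. H \<subseteq> Nb T \<and> real (card T) \<le> card C * ln d / \<phi> + 1 + card H / d"
proof (cases "H = {}")
  case True
  have "0 \<le> card C * ln d / \<phi>" using d_pos assms(3) by simp
  then show ?thesis using True by (intro exI[of _ "{}"]) (simp del: zero_le_divide_iff zero_le_mult_iff)
next
  case False
  define k where "k = nat \<lceil>card C * ln d / \<phi>\<rceil>"
  obtain T where T: "T \<subseteq> C" "card T \<le> k"
    "real (card (H - Nb T)) \<le> real (card H) * (1 - \<phi> / card C) ^ k"
    using greedy_cover[OF assms False] by blast
  have finC: "finite C" by (rule finite_subset_L[OF assms(1)])
  have finH: "finite H" using assms(2) finite_R finite_subset by blast
  obtain v where "v \<in> H" using False by auto
  have "\<phi> \<le> card (nb v \<inter> C)" by (rule assms(4)[OF \<open>v \<in> H\<close>])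
  also have "\<dots> \<le> card C" using finC by (simp add: card_mono)
  finally have phiC: "\<phi> \<le> card C" .
  then have Cpos: "card C > 0" using assms(3) by linarith
  have pos: "0 \<le> card C * ln d / \<phi>" using d_pos assms(3) by simp
  have k: "card C * ln d / \<phi> \<le> k" "k \<le> card C * ln d / \<phi> + 1"
    using pos unfolding k_def by linarith+
  have "(1 - \<phi> / card C) ^ k \<le> exp (- \<phi> / card C) ^ k"
    using exp_ge_add_one_self[of "- \<phi> / card C"] phiC Cpos by (intro power_mono) (auto simp: field_simps)
  also have "\<dots> = exp (- (\<phi> * k / card C))" by (simp flip: exp_of_nat_mult add: mult_ac)
  also have "\<dots> \<le> exp (- ln d)" using k(1) assms(3) Cpos by (simp add: field_simps)
  also have "\<dots> = 1 / d" using d_pos by (simp add: exp_minus inverse_eq_divide)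
  finally have "card H * (1 - \<phi> / card C) ^ k \<le> card H * (1 / d)" by (intro mult_left_mono) auto
  with T(3) have rest: "real (card (H - Nb T)) \<le> card H / d" by simp
  have "\<exists>u. u \<in> nb v \<inter> C" if "v \<in> H" for v
    using assms(4)[OF that] assms(3) by (cases "nb v \<inter> C = {}") auto
  then obtain f where f: "\<And>v. v \<in> H \<Longrightarrow> f v \<in> nb v \<inter> C" by metis
  let ?T = "T \<union> f ` (H - Nb T)"
  have "?T \<subseteq> C" using T(1) f by auto
  moreover have "H \<subseteq> Nb ?T"
  proof
    fix v assume v: "v \<in> H"
    then have "v \<in> nb (f v)" using f[OF v] nb_sym[of "f v" v] assms(1,2) by auto
    then show "v \<in> Nb ?T" using v unfolding Nb_def by blast
  qed
  moreover have "real (card ?T) \<le> card C * ln d / \<phi> + 1 + card H / d"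
  proof -
    have "card ?T \<le> card T + card (f ` (H - Nb T))" by (rule card_Un_le)
    also have "card (f ` (H - Nb T)) \<le> card (H - Nb T)" using finH by (intro card_image_le) auto
    finally have "real (card ?T) \<le> real (card T) + real (card (H - Nb T))" by linarith
    then show ?thesis using T(2) rest k by linarith
  qed
  ultimately show ?thesis by blast
qed

text \<open>The vertices of \<open>L\<close> all but at most \<open>\<psi>\<close> of whose neighbours lie in \<open>Nb T\<close>.\<close>
definition core :: "real \<Rightarrow> 'a set \<Rightarrow> 'a set" where
  "core \<psi> T = {u \<in> L. real (card (nb u - Nb T)) \<le> \<psi>}"

text \<open>The approximation of a closed set \<open>C = cl A\<close> with neighbourhood \<open>G = Nb A\<close>, where
  \<open>t = card G - card C\<close>. A small set \<open>T \<subseteq> C\<close> determines \<open>F = Nb T \<subseteq> G\<close> and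
  \<open>S = core \<psi> T \<supseteq> C\<close> such that \<open>S\<close> is hardly larger than \<open>F\<close>.

  \<open>T\<close> consists of a cover \<open>T1\<close> of the vertices of \<open>G\<close> with at least \<open>\<phi>\<close> neighbours in \<open>C\<close>
  and of the set \<open>T2\<close> of those vertices of \<open>C\<close> with more than \<open>\<psi>\<close> neighbours outside
  \<open>Nb T1\<close>. A vertex that \<open>T1\<close> does not cover sends more than half of its edges out of
  \<open>C\<close>, and only \<open>d * t\<close> edges leave \<open>C \<union> G\<close>; so there are at most \<open>2 * t\<close> such vertices, they
  have few edges to \<open>C\<close>, and \<open>T2\<close> is small. The same count of edges shows that \<open>S - C\<close> has
  at most \<open>2 * t\<close> elements. The last bound compares \<open>d * card S\<close> with the number of edges
  between \<open>S\<close> and \<open>F\<close>.\<close>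
lemma approximation:
  assumes A: "A \<subseteq> L" "A \<noteq> {}" "linked near A"
    and phi: "0 < \<phi>" "\<phi> \<le> d / 2" and psi: "0 < \<psi>" "\<psi> \<le> d / 2"
    and a: "a = card (cl A)" and g: "g = card (Nb A)" and t: "t = real g - real a"
  shows "\<exists>T\<subseteq>cl A. T \<noteq> {} \<and> linked near3 T
    \<and> real (card T) \<le> a * ln d / \<phi> + 1 + g / d + 2 * t * \<phi> / \<psi>
    \<and> cl A \<subseteq> core \<psi> T \<and> real (card (core \<psi> T)) \<le> a + 2 * t
    \<and> real (card (core \<psi> T)) \<le> card (Nb T) + 2 * t * (\<phi> + \<psi>) / d"
proof -
  let ?C = "cl A" and ?G = "Nb A"
  have CL: "?C \<subseteq> L" by (rule cl_subset)
  have finC: "finite ?C" by (rule finite_subset_L[OF CL])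
  have GR: "?G \<subseteq> R" by (rule Nb_subset[OF A(1)])
  have finG: "finite ?G" by (rule finite_Nb[OF A(1)])
  have NC: "Nb ?C = ?G" by (rule Nb_cl[OF A(1)])
  have ag: "a \<le> g" using card_Nb_ge[OF CL] NC a g by simp
  have dpos: "real d > 0" using d_pos by simp
  have out: "(\<Sum>v\<in>?G. real (card (nb v \<inter> (L - ?C)))) = d * t"
    using edges_out_of_Nb[OF CL] ag unfolding NC t a[symmetric] g[symmetric]
    by (simp flip: of_nat_sum add: of_nat_diff)
  \<comment> \<open>vertices of \<open>G\<close> of large degree into \<open>C\<close>; \<open>W\<close> below is the part of \<open>G\<close> missed by \<open>T1\<close>\<close>
  define H where "H = {v \<in> ?G. \<phi> \<le> real (card (nb v \<inter> ?C))}"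
  have "\<exists>T\<subseteq>?C. H \<subseteq> Nb T \<and> real (card T) \<le> card ?C * ln d / \<phi> + 1 + card H / d"
    by (rule covering_subset[OF CL]) (use GR phi in \<open>auto simp: H_def\<close>)
  then obtain T1 where T1: "T1 \<subseteq> ?C" "H \<subseteq> Nb T1"
    "real (card T1) \<le> card ?C * ln d / \<phi> + 1 + card H / d" by blast
  have "card H \<le> g" unfolding H_def g using finG by (intro card_mono) auto
  then have "card H / d \<le> g / d" using dpos by (simp add: divide_right_mono)
  then have T1_card: "real (card T1) \<le> a * ln d / \<phi> + 1 + g / d" using T1(3) unfolding a[symmetric] by linarith
  let ?W = "?G - Nb T1"
  have WR: "?W \<subseteq> R" using GR by auto
  have W_low: "real (card (nb v \<inter> ?C)) \<le> \<phi>" if "v \<in> ?W" for v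
    using that T1(2) by (force simp: H_def)
  have "card ?W * (d / 2) \<le> d * t"
  proof -
    have "card ?W * (d / 2) = (\<Sum>v\<in>?W. real d / 2)" by simp
    also have "\<dots> \<le> (\<Sum>v\<in>?W. real (card (nb v \<inter> (L - ?C))))"
    proof (rule sum_mono)
      fix v assume v: "v \<in> ?W"
      then have vR: "v \<in> R" using GR by auto
      have "card (nb v) = card ((nb v \<inter> ?C) \<union> (nb v \<inter> (L - ?C)))"
        using nb_R[OF vR] by (intro arg_cong[where f = card]) auto
      also have "\<dots> \<le> card (nb v \<inter> ?C) + card (nb v \<inter> (L - ?C))" by (rule card_Un_le)
      finally show "real d / 2 \<le> card (nb v \<inter> (L - ?C))"
        using W_low[OF v] phi(2) deg_R[OF vR] by linarith
    qed
    also have "\<dots> \<le> (\<Sum>v\<in>?G. real (card (nb v \<inter> (L - ?C))))"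
      using finG by (intro sum_mono2) auto
    finally show ?thesis using out by simp
  qed
  then have W_card: "card ?W \<le> 2 * t" using dpos by (simp add: field_simps)
  have W_edges: "(\<Sum>u\<in>?C. real (card (nb u \<inter> ?W))) \<le> 2 * t * \<phi>"
  proof -
    have "(\<Sum>u\<in>?C. real (card (nb u \<inter> ?W))) = real (\<Sum>u\<in>?C. card (nb u \<inter> ?W))" by simp
    also have "\<dots> = real (\<Sum>v\<in>?W. card (nb v \<inter> ?C))"
      by (simp only: edges_count[OF CL WR])
    also have "\<dots> = (\<Sum>v\<in>?W. real (card (nb v \<inter> ?C)))" by simp
    also have "\<dots> \<le> (\<Sum>v\<in>?W. \<phi>)" by (intro sum_mono W_low)
    also have "\<dots> = card ?W * \<phi>" by simp
    also have "\<dots> \<le> 2 * t * \<phi>" using W_card phi(1) by (intro mult_right_mono) auto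
    finally show ?thesis .
  qed
  have C_nb: "nb u - X = nb u \<inter> (?G - X)" if "u \<in> ?C" for u X
    using that by (auto simp: cl_def)
  define T2 where "T2 = {u \<in> ?C. \<psi> < real (card (nb u - Nb T1))}"
  have "card T2 * \<psi> = (\<Sum>u\<in>T2. \<psi>)" by simp
  also have "\<dots> \<le> (\<Sum>u\<in>T2. real (card (nb u - Nb T1)))" by (intro sum_mono) (auto simp: T2_def)
  also have "\<dots> = (\<Sum>u\<in>T2. real (card (nb u \<inter> ?W)))"
    using C_nb by (intro sum.cong refl) (auto simp: T2_def)
  also have "\<dots> \<le> (\<Sum>u\<in>?C. real (card (nb u \<inter> ?W)))"
    using finC by (intro sum_mono2) (auto simp: T2_def)
  finally have T2_card: "card T2 \<le> 2 * t * \<phi> / \<psi>" using W_edges psi(1) by (simp add: field_simps)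
  define T where "T = T1 \<union> T2"
  let ?F = "Nb T" and ?S = "core \<psi> T"
  have TC: "T \<subseteq> ?C" using T1(1) by (auto simp: T_def T2_def)
  have FG: "?F \<subseteq> ?G" using Nb_mono[OF TC] NC by simp
  have FR: "?F \<subseteq> R" using FG GR by blast
  have F1F: "Nb T1 \<subseteq> ?F" by (rule Nb_mono) (simp add: T_def)
  have T_card: "real (card T) \<le> a * ln d / \<phi> + 1 + g / d + 2 * t * \<phi> / \<psi>"
    using card_Un_le[of T1 T2] T1_card T2_card unfolding T_def by linarith
  have miss: "real (card (nb u - ?F)) \<le> \<psi>" if u: "u \<in> ?C" for u
  proof (cases "u \<in> T2")
    case True
    then have "nb u - ?F = {}" by (auto simp: T_def Nb_def)
    then show ?thesis using psi by (metis card.empty of_nat_0 less_imp_le)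
  next
    case False
    have "card (nb u - ?F) \<le> card (nb u - Nb T1)"
      using F1F finite_nb(1)[of u] u CL by (intro card_mono) auto
    also have "\<dots> \<le> \<psi>" using False u by (auto simp: T2_def)
    finally show ?thesis by simp
  qed
  have CS: "?C \<subseteq> ?S" using miss CL by (auto simp: core_def)
  have SL: "?S \<subseteq> L" by (auto simp: core_def)
  have finS: "finite ?S" by (rule finite_subset_L[OF SL])
  have split_deg: "real d = card (nb u \<inter> X) + real (card (nb u - X))" if "u \<in> L" for u X
  proof -
    have "card (nb u) = card (nb u \<inter> X) + card (nb u - X)"
      using finite_nb(1)[OF that] by (subst card_Un_disjoint[symmetric]) (auto intro!: arg_cong[where f = card])
    then show ?thesis using deg_L[OF that] by simp
  qed
  have dense: "\<exists>s\<in>T. near u s" if u: "u \<in> ?C" for u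
  proof -
    have "card (nb u \<inter> ?F) \<noteq> 0"
      using split_deg[of u ?F] miss[OF u] psi dpos u CL by auto
    then obtain v where "v \<in> nb u" "v \<in> ?F" by (metis card.empty disjoint_iff)
    then show ?thesis unfolding Nb_def near_def by blast
  qed
  have T_linked: "linked near3 T"
    by (rule linked_near3_dense[OF CL linked_cl[OF A(1,3)] TC dense])
  have T_ne: "T \<noteq> {}" using dense subset_cl[OF A(1)] A(2) by blast
  have extra: "card (?S - ?C) \<le> 2 * t"
  proof -
    have "card (?S - ?C) * (d / 2) = (\<Sum>u\<in>?S - ?C. real d / 2)" by simp
    also have "\<dots> \<le> (\<Sum>u\<in>?S - ?C. real (card (nb u \<inter> ?G)))"
    proof (rule sum_mono)
      fix u assume u: "u \<in> ?S - ?C"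
      then have uL: "u \<in> L" using SL by auto
      have "real d / 2 \<le> card (nb u \<inter> ?F)"
        using split_deg[OF uL, of ?F] u psi(2) by (auto simp: core_def)
      also have "\<dots> \<le> card (nb u \<inter> ?G)"
        using FG finite_nb(1)[OF uL] by (intro of_nat_mono card_mono) auto
      finally show "real d / 2 \<le> card (nb u \<inter> ?G)" .
    qed
    also have "\<dots> \<le> (\<Sum>u\<in>L - ?C. real (card (nb u \<inter> ?G)))"
      using SL finite_L by (intro sum_mono2) auto
    also have "\<dots> = real (\<Sum>u\<in>L - ?C. card (nb u \<inter> ?G))" by simp
    also have "\<dots> = real (\<Sum>v\<in>?G. card (nb v \<inter> (L - ?C)))"
      by (simp only: edges_count[OF Diff_subset GR])
    also have "\<dots> = d * t" using out by simp
    finally show ?thesis using dpos by (simp add: field_simps)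
  qed
  have S1: "card ?S \<le> a + 2 * t"
  proof -
    have "card ?S = card ?C + card (?S - ?C)"
      using CS finS finC by (subst card_Un_disjoint[symmetric]) (auto intro!: arg_cong[where f = card])
    then show ?thesis using extra a by simp
  qed
  have "d * card ?S = (\<Sum>u\<in>?S. real d)" by simp
  also have "\<dots> = (\<Sum>u\<in>?S. real (card (nb u \<inter> ?F)) + real (card (nb u - ?F)))"
    using SL split_deg by (intro sum.cong refl) auto
  also have "\<dots> = (\<Sum>u\<in>?S. real (card (nb u \<inter> ?F))) + (\<Sum>u\<in>?S. real (card (nb u - ?F)))"
    by (rule sum.distrib)
  also have "(\<Sum>u\<in>?S. real (card (nb u \<inter> ?F))) \<le> d * card ?F"
  proof -
    have "(\<Sum>u\<in>?S. real (card (nb u \<inter> ?F))) = real (\<Sum>u\<in>?S. card (nb u \<inter> ?F))" by simp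
    also have "\<dots> = real (\<Sum>v\<in>?F. card (nb v \<inter> ?S))" by (simp only: edges_count[OF SL FR])
    also have "\<dots> \<le> real (\<Sum>v\<in>?F. d)"
    proof (intro of_nat_mono sum_mono)
      fix v assume "v \<in> ?F"
      then have "v \<in> R" using FR by auto
      then show "card (nb v \<inter> ?S) \<le> d"
        using card_mono[of "nb v" "nb v \<inter> ?S"] finite_nb(2) deg_R by auto
    qed
    finally show ?thesis by (simp add: mult.commute)
  qed
  also have "(\<Sum>u\<in>?S. real (card (nb u - ?F))) =
      (\<Sum>u\<in>?C. real (card (nb u - ?F))) + (\<Sum>u\<in>?S - ?C. real (card (nb u - ?F)))"
    using CS finS by (simp add: sum.subset_diff add.commute)
  also have "(\<Sum>u\<in>?C. real (card (nb u - ?F))) \<le> (\<Sum>u\<in>?C. real (card (nb u \<inter> ?W)))"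
  proof (rule sum_mono)
    fix u assume u: "u \<in> ?C"
    have "nb u - ?F \<subseteq> nb u \<inter> ?W" using C_nb[OF u] F1F by auto
    then show "real (card (nb u - ?F)) \<le> card (nb u \<inter> ?W)"
      using finite_nb(1)[of u] u CL by (intro of_nat_mono card_mono) auto
  qed
  also note W_edges
  also have "(\<Sum>u\<in>?S - ?C. real (card (nb u - ?F))) \<le> (\<Sum>u\<in>?S - ?C. \<psi>)"
    by (intro sum_mono) (auto simp: core_def)
  also have "(\<Sum>u\<in>?S - ?C. \<psi>) = card (?S - ?C) * \<psi>" by simp
  also have "\<dots> \<le> 2 * t * \<psi>" using extra psi(1) by (intro mult_right_mono) auto
  finally have "d * real (card ?S) \<le> d * real (card ?F) + (2 * t * \<phi> + 2 * t * \<psi>)" by simp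
  then have S2: "card ?S \<le> card ?F + 2 * t * (\<phi> + \<psi>) / d"
    using dpos by (simp add: field_simps)
  show ?thesis using TC T_ne T_linked T_card CS S1 S2 by blast
qed

end

section \<open>Hard-core weights and polymers\<close>

context bireg
begin

text \<open>The weight of a set \<open>A \<subseteq> L\<close> at fugacity \<open>l\<close>: the total weight of the
  independent sets that meet \<open>L\<close> in \<open>A\<close>, divided by \<open>(1 + l) ^ card R\<close>.\<close>
definition wt :: "real \<Rightarrow> 'a set \<Rightarrow> real" where
  "wt l A = l ^ card A / (1 + l) ^ card (Nb A)"

text \<open>Polymers are the nonempty linked sets with a closure of at most half the size of \<open>L\<close>.\<close>
definition polymers :: "'a set set" where
  "polymers = {A. A \<subseteq> L \<and> A \<noteq> {} \<and> linked near A \<and> 2 * card (cl A) \<le> card L}"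

text \<open>Independent sets; edges only join \<open>L\<close> and \<open>R\<close>, so it suffices to look at neighbourhoods of
  vertices of \<open>L\<close>.\<close>
definition indep :: "'a set \<Rightarrow> bool" where
  "indep I \<longleftrightarrow> I \<subseteq> L \<union> R \<and> (\<forall>u\<in>I \<inter> L. nb u \<inter> I = {})"

lemma finite_indep: "finite {I. indep I}"
  by (rule finite_subset[of _ "Pow (L \<union> R)"]) (auto simp: indep_def finite_L finite_R)

lemma wt_nonneg: "l > 0 \<Longrightarrow> wt l A \<ge> 0"
  unfolding wt_def by simp

lemma finite_polymers: "finite polymers"
  by (rule finite_subset[of _ "Pow L"]) (auto simp: polymers_def finite_L)

text \<open>The hard-core probability that \<open>\<gamma>\<close> is a union of components of \<open>I \<inter> L\<close> is at most
  \<open>wt l \<gamma>\<close>. Indeed \<open>\<gamma>\<close> can be deleted from \<open>I\<close>, after which an arbitrary subset \<open>U\<close> of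
  \<open>Nb \<gamma>\<close> can be added, and \<open>I\<close> and \<open>U\<close> can be read off from the result.\<close>
lemma sum_with_component_le:
  fixes l :: real
  assumes l: "l > 0" and gam: "\<gamma> \<subseteq> L"
  shows "(\<Sum>I | indep I \<and> \<gamma> \<subseteq> I \<and> Nb \<gamma> \<inter> Nb (I \<inter> L - \<gamma>) = {}. l ^ card I)
    \<le> wt l \<gamma> * (\<Sum>I | indep I. l ^ card I)"
proof -
  let ?J = "{I. indep I \<and> \<gamma> \<subseteq> I \<and> Nb \<gamma> \<inter> Nb (I \<inter> L - \<gamma>) = {}}"
  let ?f = "\<lambda>(I, U). (I - \<gamma>) \<union> U"
  have NR: "Nb \<gamma> \<subseteq> R" by (rule Nb_subset[OF gam])
  have finN: "finite (Nb \<gamma>)" by (rule finite_Nb[OF gam])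
  have fing: "finite \<gamma>" by (rule finite_subset_L[OF gam])
  have dis: "I \<inter> Nb \<gamma> = {}" if "I \<in> ?J" for I
    using that gam unfolding indep_def Nb_def by blast
  have inj: "inj_on ?f (?J \<times> Pow (Nb \<gamma>))"
  proof (rule inj_onI, clarify, rule conjI)
    fix I U I' U'
    assume IU: "indep I" "\<gamma> \<subseteq> I" "Nb \<gamma> \<inter> Nb (I \<inter> L - \<gamma>) = {}" "U \<subseteq> Nb \<gamma>"
      and IU': "indep I'" "\<gamma> \<subseteq> I'" "Nb \<gamma> \<inter> Nb (I' \<inter> L - \<gamma>) = {}" "U' \<subseteq> Nb \<gamma>"
      and eq: "(I - \<gamma>) \<union> U = (I' - \<gamma>) \<union> U'"
    have d: "I \<inter> Nb \<gamma> = {}" "I' \<inter> Nb \<gamma> = {}" using dis IU IU' by auto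
    have "U = ((I - \<gamma>) \<union> U) \<inter> Nb \<gamma>" using d IU(4) by auto
    also have "\<dots> = ((I' - \<gamma>) \<union> U') \<inter> Nb \<gamma>" using eq by simp
    also have "\<dots> = U'" using d IU'(4) by auto
    finally show "U = U'" .
    have "I = (((I - \<gamma>) \<union> U) - Nb \<gamma>) \<union> \<gamma>" using d(1) IU(2,4) by blast
    also have "\<dots> = (((I' - \<gamma>) \<union> U') - Nb \<gamma>) \<union> \<gamma>" using eq by simp
    also have "\<dots> = I'" using d(2) IU'(2,4) by blast
    finally show "I = I'" .
  qed
  have img: "?f ` (?J \<times> Pow (Nb \<gamma>)) \<subseteq> {I. indep I}"
  proof clarify
    fix I U assume IU: "indep I" "\<gamma> \<subseteq> I" "Nb \<gamma> \<inter> Nb (I \<inter> L - \<gamma>) = {}" "U \<subseteq> Nb \<gamma>"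
    have UL: "U \<inter> L = {}" using IU(4) NR disjoint_LR by blast
    have "nb u \<inter> (I - \<gamma> \<union> U) = {}" if u: "u \<in> (I - \<gamma> \<union> U) \<inter> L" for u
    proof -
      have "u \<in> I \<inter> L - \<gamma>" using u UL by blast
      then have "nb u \<inter> I = {}" "nb u \<subseteq> Nb (I \<inter> L - \<gamma>)" using IU(1) by (auto simp: indep_def Nb_def)
      then show ?thesis using IU(3,4) by blast
    qed
    moreover have "I - \<gamma> \<union> U \<subseteq> L \<union> R" using IU(1,4) NR by (auto simp: indep_def)
    ultimately show "indep (I - \<gamma> \<union> U)" unfolding indep_def by blast
  qed
  have "(\<Sum>I\<in>?J. l ^ card I) * (1 + l) ^ card (Nb \<gamma>) =
      (\<Sum>I\<in>?J. l ^ card I) * (\<Sum>U\<in>Pow (Nb \<gamma>). l ^ card U)"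
    by (simp only: sum_Pow_power_card[OF finN])
  also have "\<dots> = (\<Sum>(I, U)\<in>?J \<times> Pow (Nb \<gamma>). l ^ card I * l ^ card U)"
    by (simp only: sum_product sum.cartesian_product)
  also have "\<dots> = (\<Sum>p\<in>?J \<times> Pow (Nb \<gamma>). l ^ card \<gamma> * l ^ card (?f p))"
  proof (intro sum.cong refl, clarify)
    fix I U assume IU: "indep I" "\<gamma> \<subseteq> I" "Nb \<gamma> \<inter> Nb (I \<inter> L - \<gamma>) = {}" "U \<subseteq> Nb \<gamma>"
    have finI: "finite I" using IU(1) finite_L finite_R unfolding indep_def
      by (meson finite_UnI finite_subset)
    have finU: "finite U" by (rule finite_subset[OF IU(4) finN])
    have "card (I - \<gamma> \<union> U) = card (I - \<gamma>) + card U"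
      using finI finU dis[of I] IU by (intro card_Un_disjoint) auto
    moreover have "card I = card \<gamma> + card (I - \<gamma>)"
      using IU(2) finI fing by (subst card_Un_disjoint[symmetric]) (auto intro!: arg_cong[where f = card])
    ultimately show "l ^ card I * l ^ card U = l ^ card \<gamma> * l ^ card (I - \<gamma> \<union> U)"
      by (simp add: power_add)
  qed
  also have "\<dots> = l ^ card \<gamma> * (\<Sum>p\<in>?J \<times> Pow (Nb \<gamma>). l ^ card (?f p))"
    by (simp only: sum_distrib_left)
  also have "(\<Sum>p\<in>?J \<times> Pow (Nb \<gamma>). l ^ card (?f p)) = (\<Sum>I\<in>?f ` (?J \<times> Pow (Nb \<gamma>)). l ^ card I)"
    by (simp only: sum.reindex[OF inj] o_def)
  also have "l ^ card \<gamma> * \<dots> \<le> l ^ card \<gamma> * (\<Sum>I | indep I. l ^ card I)"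
    using l img finite_indep by (intro mult_left_mono sum_mono2) auto
  finally have "(\<Sum>I\<in>?J. l ^ card I) * (1 + l) ^ card (Nb \<gamma>)
      \<le> l ^ card \<gamma> * (\<Sum>I | indep I. l ^ card I)" .
  then show ?thesis using l unfolding wt_def by (simp add: field_simps)
qed

lemma indep_swap: "bireg.indep R L nb I \<longleftrightarrow> indep I"
proof -
  interpret S: bireg R L nb d by (rule swap)
  show ?thesis
    unfolding S.indep_def indep_def using nb_sym nb_L nb_R by blast
qed

lemma component_exists:
  assumes "I \<inter> L \<noteq> {}"
  obtains \<gamma> where "\<gamma> \<subseteq> I \<inter> L" "\<gamma> \<noteq> {}" "linked near \<gamma>" "Nb \<gamma> \<inter> Nb (I \<inter> L - \<gamma>) = {}"
proof -
  have "finite (I \<inter> L)" using finite_L by simp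
  then obtain C where C: "C \<subseteq> I \<inter> L" "C \<noteq> {}" "linked near C"
    "\<And>x y. x \<in> C \<Longrightarrow> y \<in> I \<inter> L - C \<Longrightarrow> \<not> near x y"
    using linked_component_exists[of "I \<inter> L" near] assms near_sym by metis
  have "Nb C \<inter> Nb (I \<inter> L - C) = {}"
    using C(4) unfolding near_def Nb_def by blast
  then show ?thesis using C that by blast
qed

text \<open>For an independent set the closure of \<open>\<gamma>' \<subseteq> R\<close> is disjoint from the neighbourhood of
  \<open>\<gamma> \<subseteq> L\<close>, and neighbourhoods are at least as large as closures.\<close>
lemma closures_not_both_large:
  assumes "indep I" "\<gamma> \<subseteq> I \<inter> L" "\<gamma>' \<subseteq> I \<inter> R"
  shows "2 * card (cl \<gamma>) \<le> card L \<or> 2 * card (bireg.cl R nb \<gamma>') \<le> card R"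
proof -
  interpret S: bireg R L nb d by (rule swap)
  have gL: "\<gamma> \<subseteq> L" using assms by auto
  have "Nb \<gamma> \<inter> S.cl \<gamma>' = {}"
  proof (rule ccontr)
    assume "\<not> ?thesis"
    then obtain v u where v: "v \<in> S.cl \<gamma>'" and u: "u \<in> \<gamma>" "v \<in> nb u" by (auto simp: Nb_def)
    have "v \<in> R" using v by (auto simp: S.cl_def)
    then have "u \<in> nb v" using u gL nb_sym[of u v] by auto
    then have "u \<in> S.Nb \<gamma>'" using v by (auto simp: S.cl_def)
    then obtain y where y: "y \<in> \<gamma>'" "u \<in> nb y" by (auto simp: S.Nb_def)
    then have "y \<in> nb u" using assms(3) u gL nb_sym[of u y] by auto
    moreover have "u \<in> I \<inter> L" "y \<in> I" using assms(2,3) y u by auto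
    ultimately show False using assms(1) unfolding indep_def by blast
  qed
  then have "card (Nb \<gamma>) + card (S.cl \<gamma>') = card (Nb \<gamma> \<union> S.cl \<gamma>')"
    using finite_Nb[OF gL] S.cl_subset finite_R by (intro card_Un_disjoint[symmetric]) (auto intro: finite_subset)
  also have "\<dots> \<le> card R"
    using Nb_subset[OF gL] S.cl_subset finite_R by (intro card_mono) auto
  finally have "card (Nb \<gamma>) + card (S.cl \<gamma>') \<le> card R" .
  moreover have "card (cl \<gamma>) \<le> card (Nb \<gamma>)"
    using card_Nb_ge[OF cl_subset] Nb_cl[OF gL] by metis
  ultimately show ?thesis using card_L_eq_card_R by linarith
qed

text \<open>If an independent set meets both classes, then a component on one of the two sides is a
  polymer. The union bound over this component estimates the hard-core probability of meeting both
  classes by the total weight of the polymers of both sides.\<close>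
theorem two_sided_weight_le:
  fixes l :: real
  assumes l: "l > 0"
  shows "(\<Sum>I | indep I \<and> I \<inter> L \<noteq> {} \<and> I \<inter> R \<noteq> {}. l ^ card I) \<le>
    ((\<Sum>A\<in>polymers. wt l A) + (\<Sum>A\<in>bireg.polymers R nb. bireg.wt nb l A)) * (\<Sum>I | indep I. l ^ card I)"
proof -
  interpret S: bireg R L nb d by (rule swap)
  let ?J = "\<lambda>A. {I. indep I \<and> A \<subseteq> I \<and> Nb A \<inter> Nb (I \<inter> L - A) = {}}"
  let ?K = "\<lambda>A. {I. S.indep I \<and> A \<subseteq> I \<and> S.Nb A \<inter> S.Nb (I \<inter> R - A) = {}}"
  let ?Z = "\<Sum>I | indep I. l ^ card I"
  have finJ: "finite (?J A)" for A by (rule finite_subset[OF _ finite_indep]) auto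
  have finK: "finite (?K A)" for A by (rule finite_subset[OF _ S.finite_indep]) auto
  have nonneg: "l ^ card I \<ge> 0" for I :: "'a set" using l by simp
  have sub: "{I. indep I \<and> I \<inter> L \<noteq> {} \<and> I \<inter> R \<noteq> {}} \<subseteq> (\<Union>A\<in>polymers. ?J A) \<union> (\<Union>A\<in>S.polymers. ?K A)"
  proof clarify
    fix I assume I: "indep I" "I \<inter> L \<noteq> {}" "I \<inter> R \<noteq> {}" and no: "I \<notin> (\<Union>A\<in>S.polymers. ?K A)"
    obtain A where A: "A \<subseteq> I \<inter> L" "A \<noteq> {}" "linked near A" "Nb A \<inter> Nb (I \<inter> L - A) = {}"
      using component_exists[OF I(2)] .
    obtain B where B: "B \<subseteq> I \<inter> R" "B \<noteq> {}" "linked S.near B" "S.Nb B \<inter> S.Nb (I \<inter> R - B) = {}"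
      using S.component_exists[OF I(3)] .
    have "I \<in> ?K B" using B I(1) indep_swap by blast
    then have "B \<notin> S.polymers" using no by blast
    then have "2 * card (cl A) \<le> card L"
      using closures_not_both_large[OF I(1) A(1) B(1)] B by (auto simp: S.polymers_def)
    then have "A \<in> polymers" using A by (auto simp: polymers_def)
    moreover have "I \<in> ?J A" using A I(1) by blast
    ultimately show "I \<in> (\<Union>A\<in>polymers. ?J A)" by blast
  qed
  have "(\<Sum>I | indep I \<and> I \<inter> L \<noteq> {} \<and> I \<inter> R \<noteq> {}. l ^ card I)
      \<le> (\<Sum>I\<in>(\<Union>A\<in>polymers. ?J A) \<union> (\<Union>A\<in>S.polymers. ?K A). l ^ card I)"
    using finite_polymers S.finite_polymers finJ finK nonneg by (intro sum_mono2 sub) auto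
  also have "\<dots> \<le> (\<Sum>I\<in>(\<Union>A\<in>polymers. ?J A). l ^ card I) + (\<Sum>I\<in>(\<Union>A\<in>S.polymers. ?K A). l ^ card I)"
    using sum.union_inter[of "\<Union>A\<in>polymers. ?J A" "\<Union>A\<in>S.polymers. ?K A" "\<lambda>I. l ^ card I"]
      finite_polymers S.finite_polymers finJ finK
      sum_nonneg[of "(\<Union>A\<in>polymers. ?J A) \<inter> (\<Union>A\<in>S.polymers. ?K A)" "\<lambda>I. l ^ card I"] nonneg
    by simp
  also have "(\<Sum>I\<in>(\<Union>A\<in>polymers. ?J A). l ^ card I) \<le> (\<Sum>A\<in>polymers. \<Sum>I\<in>?J A. l ^ card I)"
    by (intro sum_UN_le finite_polymers finJ nonneg)
  also have "\<dots> \<le> (\<Sum>A\<in>polymers. wt l A * ?Z)"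
    using l by (intro sum_mono sum_with_component_le) (auto simp: polymers_def)
  also have "(\<Sum>I\<in>(\<Union>A\<in>S.polymers. ?K A). l ^ card I) \<le> (\<Sum>A\<in>S.polymers. \<Sum>I\<in>?K A. l ^ card I)"
    by (intro sum_UN_le S.finite_polymers finK nonneg)
  also have "\<dots> \<le> (\<Sum>A\<in>S.polymers. S.wt l A * (\<Sum>I | S.indep I. l ^ card I))"
    using l by (intro sum_mono S.sum_with_component_le) (auto simp: S.polymers_def)
  also have "(\<Sum>I | S.indep I. l ^ card I) = ?Z" by (simp only: indep_swap)
  finally show ?thesis by (simp add: sum_distrib_right distrib_right)
qed

end

section \<open>Weight of linked sets of given closure and neighbourhood size\<close>

context bireg
begin

text \<open>Linked sets with prescribed sizes of closure and neighbourhood.\<close>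
definition family :: "nat \<Rightarrow> nat \<Rightarrow> 'a set set" where
  "family a g = {A. A \<subseteq> L \<and> A \<noteq> {} \<and> linked near A \<and> card (cl A) = a \<and> card (Nb A) = g}"

lemma finite_family: "finite (family a g)"
  by (rule finite_subset[of _ "Pow L"]) (auto simp: family_def finite_L)

lemma sum_wt_subsets_le:
  fixes l s :: real
  assumes "l \<ge> 1" "K \<subseteq> L" "\<And>A. A \<in> \<A> \<Longrightarrow> A \<subseteq> K \<and> card (Nb A) = g"
    and "s \<ge> 0" "card K + s \<le> g"
  shows "(\<Sum>A\<in>\<A>. wt l A) \<le> 2 powr (- s)"
proof -
  have finK: "finite K" by (rule finite_subset_L[OF assms(2)])
  have "(\<Sum>A\<in>\<A>. wt l A) = (\<Sum>A\<in>\<A>. l ^ card A / (1 + l) ^ g)"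
    using assms(3) by (intro sum.cong) (auto simp: wt_def)
  also have "\<dots> \<le> (\<Sum>A\<in>Pow K. l ^ card A / (1 + l) ^ g)"
    using assms finK by (intro sum_mono2) auto
  also have "\<dots> = (1 + l) ^ card K / (1 + l) ^ g"
    by (simp only: sum_divide_distrib[symmetric] sum_Pow_power_card[OF finK])
  also have "\<dots> = (1 + l) powr (real (card K) - real g)"
    using assms(1) by (simp add: powr_diff powr_realpow)
  also have "\<dots> \<le> (1 + l) powr (- s)" using assms by (intro powr_mono) auto
  also have "\<dots> \<le> 2 powr (- s)" using assms by (intro powr_mono2') auto
  finally show ?thesis .
qed

text \<open>The total weight of the linked sets \<open>A\<close> with \<open>card (cl A) = a\<close> and \<open>card (Nb A) = g\<close>. The
  factor in front counts the possible approximations \<open>T\<close>. For a fixed \<open>T\<close>, either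
  \<open>core \<psi> T\<close> is smaller than \<open>g\<close> by \<open>\<kappa> * t\<close>, and then it is enough that \<open>A\<close> is one of its
  subsets; or \<open>Nb A\<close> has only a few vertices outside \<open>Nb T\<close>, and then these are specified as well,
  which determines \<open>Nb A\<close> and leaves \<open>A\<close> to be a subset of the \<open>a\<close> vertices of \<open>cl A\<close>.\<close>
lemma container_sum:
  fixes l \<phi> \<psi> y \<kappa> t :: real and a g m :: nat
  assumes l: "l \<ge> 1" and phi: "0 < \<phi>" "\<phi> \<le> d / 2" and psi: "0 < \<psi>" "\<psi> \<le> d / 2"
    and y: "0 < y" "y \<le> 1" and kap: "\<kappa> \<ge> 0" and t: "t = real g - real a" and m: "m > 0"
    and bd: "a * ln d / \<phi> + 1 + g / d + 2 * t * \<phi> / \<psi> \<le> m"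
  shows "(\<Sum>A\<in>family a g. wt l A) \<le> real (card L * (d ^ 6) ^ (2 * (m - 1))) *
    (2 powr (- (\<kappa> * t)) + exp (y * (d * (a + 2 * t))) * y powr (- (\<kappa> * t + 2 * t * (\<phi> + \<psi>) / d)) * 2 powr (- t))"
    (is "_ \<le> _ * (?b1 + ?b2)")
proof (cases "family a g = {}")
  case True
  then show ?thesis by (simp add: y(1) less_imp_le)
next
  case False
  then obtain A0 where "A0 \<in> family a g" by blast
  then have A0: "A0 \<subseteq> L" "card (cl A0) = a" "card (Nb A0) = g" by (auto simp: family_def)
  have "a \<le> g" using card_Nb_ge[OF cl_subset[of A0]] Nb_cl[OF A0(1)] A0 by simp
  then have t0: "t \<ge> 0" using t by simp
  define \<T> where "\<T> = {T. T \<subseteq> L \<and> T \<noteq> {} \<and> linked near3 T \<and> card T \<le> m}"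
  define r where "r = \<kappa> * t + 2 * t * (\<phi> + \<psi>) / d"
  define Fam where "Fam T = {A \<in> family a g. Nb T \<subseteq> Nb A \<and> cl A \<subseteq> core \<psi> T
    \<and> real (card (core \<psi> T)) \<le> a + 2 * t
    \<and> real (card (core \<psi> T)) \<le> card (Nb T) + 2 * t * (\<phi> + \<psi>) / d}" for T
  have finT: "finite \<T>" by (rule finite_subset[of _ "Pow L"]) (auto simp: \<T>_def finite_L)
  have finF: "finite (Fam T)" for T using finite_family by (auto simp: Fam_def)
  have wt0: "wt l A \<ge> 0" for A using l by (intro wt_nonneg) auto
  have cover: "family a g \<subseteq> (\<Union>T\<in>\<T>. Fam T)"
  proof
    fix A assume A: "A \<in> family a g"
    then have A': "A \<subseteq> L" "A \<noteq> {}" "linked near A" "a = card (cl A)" "g = card (Nb A)"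
      by (auto simp: family_def)
    obtain T where T: "T \<subseteq> cl A" "T \<noteq> {}" "linked near3 T"
      "real (card T) \<le> a * ln d / \<phi> + 1 + g / d + 2 * t * \<phi> / \<psi>" "cl A \<subseteq> core \<psi> T"
      "real (card (core \<psi> T)) \<le> a + 2 * t"
      "real (card (core \<psi> T)) \<le> card (Nb T) + 2 * t * (\<phi> + \<psi>) / d"
      using approximation[OF A'(1-3) phi psi A'(4,5) t]
      by (elim exE conjE) (rule that; assumption)
    have "T \<in> \<T>" using T(1-4) bd cl_subset[of A] by (auto simp: \<T>_def)
    moreover have "Nb T \<subseteq> Nb A" using Nb_mono[OF T(1)] Nb_cl[OF A'(1)] by simp
    ultimately show "A \<in> (\<Union>T\<in>\<T>. Fam T)" using A T(5-7) by (auto simp: Fam_def)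
  qed
  have one: "(\<Sum>A\<in>Fam T. wt l A) \<le> ?b1 + ?b2" if T: "T \<in> \<T>" for T
  proof (cases "Fam T = {}")
    case True
    then show ?thesis by simp
  next
    case nonempty: False
    let ?S = "core \<psi> T" and ?F = "Nb T"
    have SL: "?S \<subseteq> L" by (auto simp: core_def)
    have TL: "T \<subseteq> L" using T by (auto simp: \<T>_def)
    have b2: "?b2 \<ge> 0" by simp
    have S1: "card ?S \<le> a + 2 * t" and S2: "card ?S \<le> card ?F + 2 * t * (\<phi> + \<psi>) / d"
      using nonempty by (auto simp: Fam_def)
    show ?thesis
    proof (cases "card ?S + \<kappa> * t \<le> g")
      case True
      have "(\<Sum>A\<in>Fam T. wt l A) \<le> ?b1"
      proof (rule sum_wt_subsets_le[OF l SL _ _ True])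
        fix A assume "A \<in> Fam T"
        then show "A \<subseteq> ?S \<and> card (Nb A) = g"
          using subset_cl[of A] by (auto simp: Fam_def family_def)
      qed (use kap t0 in simp)
      then show ?thesis using b2 by linarith
    next
      case False
      define K where "K U = {u \<in> L. nb u \<subseteq> ?F \<union> U}" for U
      define \<U> where "\<U> = {U. U \<subseteq> Nb ?S \<and> real (card U) \<le> r}"
      define FU where "FU U = {A \<in> Fam T. Nb A = ?F \<union> U}" for U
      have finU: "finite \<U>" unfolding \<U>_def using finite_Nb[OF SL] by simp
      have sub: "Fam T \<subseteq> (\<Union>U\<in>\<U>. FU U)"
      proof
        fix A assume A: "A \<in> Fam T"
        then have AL: "A \<subseteq> L" and FA: "?F \<subseteq> Nb A" and AS: "cl A \<subseteq> ?S" and cg: "card (Nb A) = g"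
          by (auto simp: Fam_def family_def)
        let ?U = "Nb A - ?F"
        have "card ?U = card (Nb A) - card ?F"
          using finite_Nb[OF TL] FA by (intro card_Diff_subset)
        moreover have "card ?F \<le> g" using FA cg finite_Nb[OF AL] card_mono by metis
        ultimately have "real (card ?U) = real g - card ?F" using cg by simp
        then have "real (card ?U) \<le> r" using False S2 unfolding r_def by linarith
        moreover have "?U \<subseteq> Nb ?S" using Nb_mono[OF AS] Nb_cl[OF AL] by auto
        ultimately have "?U \<in> \<U>" by (simp add: \<U>_def)
        moreover have "A \<in> FU ?U" using A FA by (auto simp: FU_def)
        ultimately show "A \<in> (\<Union>U\<in>\<U>. FU U)" by blast
      qed
      have each: "(\<Sum>A\<in>FU U. wt l A) \<le> 2 powr (- t)" for U
      proof (cases "FU U = {}")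
        case True
        then show ?thesis by simp
      next
        case False
        then obtain A where "A \<in> FU U" by blast
        then have "card (K U) = a" by (auto simp: FU_def Fam_def family_def cl_def K_def)
        then show ?thesis
          using t t0 subset_cl
          by (intro sum_wt_subsets_le[OF l, of "K U" _ g])
            (auto simp: FU_def Fam_def family_def cl_def K_def Nb_def)
      qed
      have "(\<Sum>A\<in>Fam T. wt l A) \<le> (\<Sum>A\<in>(\<Union>U\<in>\<U>. FU U). wt l A)"
        using finF finU wt0 by (intro sum_mono2 sub) (auto simp: FU_def)
      also have "\<dots> \<le> (\<Sum>U\<in>\<U>. \<Sum>A\<in>FU U. wt l A)"
        using finF finU wt0 by (intro sum_UN_le) (auto simp: FU_def)
      also have "\<dots> \<le> (\<Sum>U\<in>\<U>. 2 powr (- t))" by (intro sum_mono each)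
      also have "\<dots> = card \<U> * 2 powr (- t)" by simp
      also have "card \<U> * 2 powr (- t) \<le> (exp (y * card (Nb ?S)) * y powr (- r)) * 2 powr (- t)"
        unfolding \<U>_def by (intro mult_right_mono card_small_subsets_le finite_Nb SL y) auto
      also have "\<dots> \<le> ?b2"
      proof -
        have "real (card (Nb ?S)) \<le> d * real (card ?S)"
          using card_Nb_le[OF SL] by (metis of_nat_le_iff of_nat_mult)
        also have "\<dots> \<le> d * (a + 2 * t)" using S1 by (intro mult_left_mono) auto
        finally show ?thesis
          unfolding r_def using y by (intro mult_right_mono) (auto intro!: mult_left_mono)
      qed
      finally show ?thesis by (simp add: add_increasing)
    qed
  qed
  have "card \<T> \<le> card L * (d ^ 6) ^ (2 * (m - 1))"
    unfolding \<T>_def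
    by (rule card_linked_sets_le[OF finite_L _ _ _ m]) (auto intro: card_near3_le near3_sym near3_refl)
  then have cT: "real (card \<T>) \<le> real (card L * (d ^ 6) ^ (2 * (m - 1)))" by (rule of_nat_mono)
  have "(\<Sum>A\<in>family a g. wt l A) \<le> (\<Sum>A\<in>(\<Union>T\<in>\<T>. Fam T). wt l A)"
    using finF finT wt0 by (intro sum_mono2 cover) auto
  also have "\<dots> \<le> (\<Sum>T\<in>\<T>. \<Sum>A\<in>Fam T. wt l A)"
    using finF finT wt0 by (intro sum_UN_le) auto
  also have "\<dots> \<le> (\<Sum>T\<in>\<T>. ?b1 + ?b2)" by (intro sum_mono one)
  also have "\<dots> = card \<T> * (?b1 + ?b2)" by simp
  also have "\<dots> \<le> real (card L * (d ^ 6) ^ (2 * (m - 1))) * (?b1 + ?b2)"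
    by (intro mult_right_mono cT) simp
  finally show ?thesis .
qed

text \<open>Small sets expand by a factor close to \<open>d\<close> if two vertices have at most two common
  neighbours, by the Cauchy-Schwarz inequality for the degrees into \<open>A\<close>.\<close>
lemma expansion_from_codegree:
  assumes codeg: "\<And>u u'. u \<in> L \<Longrightarrow> u' \<in> L \<Longrightarrow> u \<noteq> u' \<Longrightarrow> card (nb u \<inter> nb u') \<le> 2"
    and A: "A \<subseteq> L"
  shows "real (card A) * d ^ 2 \<le> real (card (Nb A)) * (d + 2 * card A)"
proof (cases "A = {}")
  case True
  then show ?thesis by simp
next
  case False
  have finA: "finite A" by (rule finite_subset_L[OF A])
  let ?G = "Nb A"
  have finG: "finite ?G" by (rule finite_Nb[OF A])
  let ?deg = "\<lambda>v. real (card (nb v \<inter> A))"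
  have GR: "?G \<subseteq> R" by (rule Nb_subset[OF A])
  have "(\<Sum>v\<in>?G. ?deg v) = real (\<Sum>v\<in>?G. card (nb v \<inter> A))" by simp
  also have "\<dots> = d * card A" by (simp only: edges_into_Nb[OF A order_refl GR] of_nat_mult)
  finally have deg1: "(\<Sum>v\<in>?G. ?deg v) = d * card A" .
  have "(\<Sum>v\<in>?G. (?deg v)\<^sup>2) = (\<Sum>v\<in>?G. \<Sum>u\<in>A. \<Sum>u'\<in>A. if v \<in> nb u \<inter> nb u' then 1 else 0)"
  proof (intro sum.cong refl)
    fix v assume "v \<in> ?G"
    then have v: "v \<in> R" using GR by auto
    have "?deg v = (\<Sum>u\<in>A. if u \<in> nb v then 1 else 0)"
      using finA by (simp add: sum.If_cases Int_commute[of A] Collect_mem_eq)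
    also have "\<dots> = (\<Sum>u\<in>A. if v \<in> nb u then 1 else 0)"
    proof (intro sum.cong refl)
      fix u assume "u \<in> A"
      then have "v \<in> nb u \<longleftrightarrow> u \<in> nb v" using A v nb_sym[of u v] by auto
      then show "(if u \<in> nb v then 1 else 0 :: real) = (if v \<in> nb u then 1 else 0)" by simp
    qed
    finally have "(?deg v)\<^sup>2 = (\<Sum>u\<in>A. if v \<in> nb u then 1 else 0) * (\<Sum>u\<in>A. if v \<in> nb u then 1 else 0)"
      by (simp add: power2_eq_square)
    also have "\<dots> = (\<Sum>u\<in>A. \<Sum>u'\<in>A. (if v \<in> nb u then 1 else 0) * (if v \<in> nb u' then 1 else 0))"
      by (rule sum_product)
    finally show "(?deg v)\<^sup>2 = (\<Sum>u\<in>A. \<Sum>u'\<in>A. if v \<in> nb u \<inter> nb u' then 1 else 0)"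
      by (simp add: if_distrib cong: if_cong)
        (intro sum.cong refl; simp)
  qed
  also have "\<dots> = (\<Sum>u\<in>A. \<Sum>v\<in>?G. \<Sum>u'\<in>A. if v \<in> nb u \<inter> nb u' then 1 else 0)"
    by (rule sum.swap)
  also have "\<dots> = (\<Sum>u\<in>A. \<Sum>u'\<in>A. \<Sum>v\<in>?G. if v \<in> nb u \<inter> nb u' then 1 else 0)"
    by (intro sum.cong refl sum.swap)
  also have "\<dots> = (\<Sum>u\<in>A. \<Sum>u'\<in>A. real (card (nb u \<inter> nb u')))"
  proof (intro sum.cong refl)
    fix u u' assume "u \<in> A" "u' \<in> A"
    then have "?G \<inter> (nb u \<inter> nb u') = nb u \<inter> nb u'" by (auto simp: Nb_def)
    then show "(\<Sum>v\<in>?G. if v \<in> nb u \<inter> nb u' then 1 else 0) = real (card (nb u \<inter> nb u'))"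
      using finG by (simp add: sum.If_cases Collect_mem_eq del: Int_iff)
  qed
  also have "\<dots> \<le> (\<Sum>u\<in>A. \<Sum>u'\<in>A. 2 + (if u' = u then real d else 0))"
  proof (intro sum_mono)
    fix u u' assume "u \<in> A" "u' \<in> A"
    then show "real (card (nb u \<inter> nb u')) \<le> 2 + (if u' = u then real d else 0)"
      using codeg[of u u'] deg_L[of u] A by (cases "u' = u") auto
  qed
  also have "\<dots> = card A * (2 * card A + d)"
    using finA by (simp add: sum.distrib algebra_simps)
  finally have deg2: "(\<Sum>v\<in>?G. (?deg v)\<^sup>2) \<le> card A * (2 * card A + d)" .
  have "(real d * card A)\<^sup>2 = (\<Sum>v\<in>?G. 1 * ?deg v)\<^sup>2" using deg1 by simp
  also have "\<dots> \<le> (\<Sum>v\<in>?G. 1\<^sup>2) * (\<Sum>v\<in>?G. (?deg v)\<^sup>2)" by (rule Cauchy_Schwarz_ineq_sum)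
  also have "\<dots> \<le> card ?G * (card A * (2 * card A + d))"
    using deg2 by (simp add: mult_left_mono)
  finally have "card A * (real (card A) * d ^ 2) \<le> card A * (card ?G * (d + 2 * card A))"
    by (simp add: power2_eq_square algebra_simps)
  then show ?thesis using False finA by (simp add: card_gt_0_iff)
qed

end

section \<open>Isoperimetry in the hypercube\<close>

text \<open>The vertex reached from \<open>x\<close> along the edge in direction \<open>i\<close>.\<close>
definition flip :: "bool list \<Rightarrow> nat \<Rightarrow> bool list" where
  "flip x i = x[i := \<not> x ! i]"

text \<open>The neighbourhood of a vertex of the hypercube of dimension \<open>length x\<close>.\<close>
definition cube_nb :: "bool list \<Rightarrow> bool list set" where
  "cube_nb x = {y. cube_adj x y}"

text \<open>The two classes of the hypercube, indexed by the parity: \<open>parity_class True\<close> is the odd one.\<close>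
definition parity_class :: "bool \<Rightarrow> nat \<Rightarrow> bool list set" where
  "parity_class p n = {x. length x = n \<and> (odd (count_list x True) \<longleftrightarrow> p)}"

lemma length_flip [simp]: "length (flip x i) = length x"
  by (simp add: flip_def)

lemma flip_nth: "i < length x \<Longrightarrow> flip x i ! j = (if j = i then \<not> x ! i else x ! j)"
  by (simp add: flip_def nth_list_update)

lemma flip_flip [simp]: "i < length x \<Longrightarrow> flip (flip x i) i = x"
  by (rule nth_equalityI) (auto simp: flip_nth)

lemma flip_Cons_0 [simp]: "flip (b # x) 0 = (\<not> b) # x"
  and flip_Cons_Suc [simp]: "flip (b # x) (Suc i) = b # flip x i"
  by (simp_all add: flip_def)

lemma flip_inj: "inj_on (flip x) {..<length x}"
proof (rule inj_onI)
  fix i j assume ij: "i \<in> {..<length x}" "j \<in> {..<length x}" "flip x i = flip x j"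
  have "flip x i ! i = (\<not> x ! i)" using ij(1) by (simp add: flip_nth)
  moreover have "flip x j ! i = x ! i" if "i \<noteq> j" using ij(2) that by (simp add: flip_nth)
  ultimately show "i = j" using ij(3) by auto
qed

lemma cube_nb_eq: "cube_nb x = flip x ` {..<length x}"
proof
  show "cube_nb x \<subseteq> flip x ` {..<length x}"
  proof
    fix y assume "y \<in> cube_nb x"
    then obtain i where i: "length x = length y" "i < length x" "x ! i \<noteq> y ! i"
      "\<And>j. j < length x \<Longrightarrow> x ! j \<noteq> y ! j \<Longrightarrow> j = i"
      unfolding cube_nb_def cube_adj_def by blast
    have "y = flip x i"
    proof (rule nth_equalityI)
      fix j assume "j < length y"
      then have "x ! j \<noteq> y ! j \<longleftrightarrow> j = i" using i by metis
      then show "y ! j = flip x i ! j" unfolding flip_nth[OF i(2)] by (cases "j = i") auto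
    qed (simp add: i(1))
    then show "y \<in> flip x ` {..<length x}" using i(2) by (intro image_eqI[of _ _ i]) auto
  qed
  show "flip x ` {..<length x} \<subseteq> cube_nb x"
  proof (rule image_subsetI)
    fix i assume "i \<in> {..<length x}"
    then have i: "i < length x" by simp
    have "\<exists>!j. j < length x \<and> x ! j \<noteq> flip x i ! j"
    proof (rule ex1I[of _ i])
      show "i < length x \<and> x ! i \<noteq> flip x i ! i" using i flip_nth[of i x i] by simp
      show "j = i" if "j < length x \<and> x ! j \<noteq> flip x i ! j" for j
        using that i flip_nth[of i x j] by (cases "j = i") simp_all
    qed
    then show "flip x i \<in> cube_nb x" unfolding cube_nb_def cube_adj_def by simp
  qed
qed

lemma card_cube_nb: "card (cube_nb x) = length x"
  by (simp add: cube_nb_eq card_image flip_inj)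

lemma cube_adj_sym: "cube_adj x y \<longleftrightarrow> cube_adj y x"
proof -
  have "cube_adj b a" if "cube_adj a b" for a b
    using that unfolding cube_adj_def by metis
  then show ?thesis by blast
qed

lemma even_count_flip:
  "i < length x \<Longrightarrow> even (count_list (flip x i) True) \<longleftrightarrow> odd (count_list x True)"
proof (induction x arbitrary: i)
  case (Cons b x)
  then show ?case by (cases i) auto
qed simp

lemma cube_nb_parity: "x \<in> parity_class p n \<Longrightarrow> cube_nb x \<subseteq> parity_class (\<not> p) n"
  by (auto simp: cube_nb_eq parity_class_def even_count_flip)

lemma finite_cube: "finite {x :: bool list. length x = n}"
  using finite_cube_vertices[of n] by (simp add: cube_vertices_def)

lemma finite_parity_class: "finite (parity_class p n)"
  by (rule finite_subset[OF _ finite_cube[of n]]) (auto simp: parity_class_def)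

lemma bireg_cube:
  assumes "n > 0"
  shows "bireg (parity_class p n) (parity_class (\<not> p) n) cube_nb n"
proof
  show "cube_nb v \<subseteq> parity_class p n" if "v \<in> parity_class (\<not> p) n" for v
    using cube_nb_parity[OF that] by simp
  show "v \<in> cube_nb u \<longleftrightarrow> u \<in> cube_nb v" for u v
    using cube_adj_sym by (auto simp: cube_nb_def)
  have deg: "card (cube_nb u) = n" if "u \<in> parity_class q n" for u q
    using that by (simp add: card_cube_nb parity_class_def)
  show "card (cube_nb u) = n" if "u \<in> parity_class p n" for u by (rule deg[OF that])
  show "card (cube_nb u) = n" if "u \<in> parity_class (\<not> p) n" for u by (rule deg[OF that])
  show "parity_class p n \<inter> parity_class (\<not> p) n = {}" by (auto simp: parity_class_def)
qed (fact finite_parity_class assms cube_nb_parity)+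

lemma cube_codegree:
  assumes "u \<noteq> u'"
  shows "card (cube_nb u \<inter> cube_nb u') \<le> 2"
proof (cases "cube_nb u \<inter> cube_nb u' = {}")
  case True
  then show ?thesis by simp
next
  case False
  then obtain v where v: "v \<in> cube_nb u" "u' \<in> cube_nb v"
    using cube_adj_sym by (auto simp: cube_nb_def)
  then obtain i where i: "i < length u" "v = flip u i" by (auto simp: cube_nb_eq)
  from v i obtain j where j: "j < length u" "u' = flip (flip u i) j" by (auto simp: cube_nb_eq)
  have "cube_nb u \<inter> cube_nb u' \<subseteq> {flip u i, flip u j}"
  proof
    fix w assume "w \<in> cube_nb u \<inter> cube_nb u'"
    then have "w \<in> cube_nb u" "u' \<in> cube_nb w" using cube_adj_sym by (auto simp: cube_nb_def)
    then obtain k m where k: "k < length u" "w = flip u k" "m < length u" "u' = flip w m"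
      by (auto simp: cube_nb_eq)
    have "k = i \<or> k = j"
    proof (rule ccontr)
      assume "\<not> (k = i \<or> k = j)"
      then have "u' ! k = u ! k" using i j k by (simp add: flip_nth)
      moreover have "m \<noteq> k" using k assms by auto
      ultimately show False using k by (simp add: flip_nth)
    qed
    then show "w \<in> {flip u i, flip u j}" using k by auto
  qed
  then have "card (cube_nb u \<inter> cube_nb u') \<le> card {flip u i, flip u j}" by (intro card_mono) auto
  also have "\<dots> \<le> 2" by (simp add: card_insert_if)
  finally show ?thesis .
qed

text \<open>The variance of a Bernoulli variable with mean \<open>x\<close>.\<close>
definition var_fn :: "real \<Rightarrow> real" where "var_fn x = x * (1 - x)"

text \<open>The square of the one-sided discrete gradient; only the directions in which \<open>f\<close> increases
  contribute.\<close>
definition up_grad_sq :: "nat \<Rightarrow> (bool list \<Rightarrow> real) \<Rightarrow> bool list \<Rightarrow> real" where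
  "up_grad_sq n f x = (\<Sum>i<n. (max 0 (f (flip x i) - f x))\<^sup>2)"

lemma up_grad_sq_nonneg: "up_grad_sq n f x \<ge> 0"
  unfolding up_grad_sq_def by (intro sum_nonneg) auto

lemma two_point_ordered:
  assumes "0 \<le> a" "a \<le> b" "b \<le> 1"
  shows "var_fn ((a + b) / 2) \<le> (sqrt ((var_fn a)\<^sup>2 + (b - a)\<^sup>2) + var_fn b) / 2"
proof -
  define e where "e = (b - a)\<^sup>2"
  have "\<bar>b - a\<bar> \<le> 1" using assms by auto
  then have e: "0 \<le> e" "e \<le> 1" unfolding e_def by (auto simp: abs_square_le_1)
  have "0 \<le> (a - 1 / 2)\<^sup>2" by simp
  then have Ia: "var_fn a \<le> 1 / 4" unfolding var_fn_def by (simp add: power2_eq_square algebra_simps)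
  have "(var_fn a + e / 2)\<^sup>2 = (var_fn a)\<^sup>2 + e * (var_fn a + e / 4)"
    by (simp add: power2_eq_square algebra_simps)
  also have "\<dots> \<le> (var_fn a)\<^sup>2 + e * 1" using Ia e by (intro add_left_mono mult_left_mono) auto
  finally have "var_fn a + e / 2 \<le> sqrt ((var_fn a)\<^sup>2 + e)" by (intro real_le_rsqrt) simp
  moreover have "var_fn ((a + b) / 2) = (var_fn a + e / 2 + var_fn b) / 2"
    unfolding e_def var_fn_def by (simp add: power2_eq_square field_simps)
  ultimately show ?thesis unfolding e_def by simp
qed

text \<open>The inequality of the next theorem in dimension one.\<close>
lemma two_point:
  assumes "0 \<le> a" "a \<le> 1" "0 \<le> b" "b \<le> 1"
  shows "var_fn ((a + b) / 2) \<le>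
    (sqrt ((var_fn a)\<^sup>2 + (max 0 (b - a))\<^sup>2) + sqrt ((var_fn b)\<^sup>2 + (max 0 (a - b))\<^sup>2)) / 2"
proof -
  have v: "var_fn x \<ge> 0" if "0 \<le> x" "x \<le> 1" for x using that by (simp add: var_fn_def)
  show ?thesis
  proof (cases "a \<le> b")
    case True
    then show ?thesis using two_point_ordered[of a b] assms v by simp
  next
    case False
    then show ?thesis using two_point_ordered[of b a] assms v by (simp add: add.commute)
  qed
qed

lemma sqrt_sum_squares_le:
  fixes u v :: "'b \<Rightarrow> real"
  shows "sqrt ((\<Sum>x\<in>A. u x)\<^sup>2 + (\<Sum>x\<in>A. v x)\<^sup>2) \<le> (\<Sum>x\<in>A. sqrt ((u x)\<^sup>2 + (v x)\<^sup>2))"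
proof -
  have "norm (\<Sum>x\<in>A. Complex (u x) (v x)) \<le> (\<Sum>x\<in>A. norm (Complex (u x) (v x)))"
    by (rule norm_sum)
  moreover have "(\<Sum>x\<in>A. Complex (u x) (v x)) = Complex (\<Sum>x\<in>A. u x) (\<Sum>x\<in>A. v x)"
    by (simp add: complex_eq_iff)
  ultimately show ?thesis by (simp add: complex_norm)
qed

lemma sum_cube_Suc:
  fixes h :: "bool list \<Rightarrow> real"
  shows "(\<Sum>x | length x = Suc n. h x) = (\<Sum>x | length x = n. h (True # x)) + (\<Sum>x | length x = n. h (False # x))"
proof -
  have "{x :: bool list. length x = Suc n} = Cons True ` {x. length x = n} \<union> Cons False ` {x. length x = n}"
    by (auto simp: length_Suc_conv)
  then have "(\<Sum>x | length x = Suc n. h x) =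
      (\<Sum>x\<in>Cons True ` {x. length x = n}. h x) + (\<Sum>x\<in>Cons False ` {x. length x = n}. h x)"
    by (simp only:) (intro sum.union_disjoint finite_imageI finite_cube; auto)
  then show ?thesis by (simp add: sum.reindex inj_on_def)
qed

lemma card_cube: "card {x :: bool list. length x = n} = 2 ^ n"
  using card_lists_length_eq[of "UNIV :: bool set" n] by simp

text \<open>A functional isoperimetric inequality in the style of Bobkov, with the variance in place of
  the Gaussian isoperimetric profile and with the one-sided gradient. The two-point inequality
  passes to higher dimensions by the triangle inequality in the Euclidean plane.\<close>
lemma one_sided_bobkov:
  assumes "\<And>x. 0 \<le> f x \<and> f x \<le> 1"
  shows "var_fn ((\<Sum>x | length x = n. f x) / 2 ^ n)
    \<le> (\<Sum>x | length x = n. sqrt ((var_fn (f x))\<^sup>2 + up_grad_sq n f x)) / 2 ^ n"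
  using assms
proof (induction n arbitrary: f)
  case 0
  have "{x :: bool list. length x = 0} = {[]}" by auto
  then show ?case by (simp add: up_grad_sq_def)
next
  case (Suc n)
  let ?Q = "{x :: bool list. length x = n}"
  define m where "m b = (\<Sum>x\<in>?Q. f (b # x)) / 2 ^ n" for b
  define u where "u b x = sqrt ((var_fn (f (b # x)))\<^sup>2 + up_grad_sq n (\<lambda>x. f (b # x)) x)" for b x
  define v where "v b x = max 0 (f ((\<not> b) # x) - f (b # x))" for b x
  have m01: "0 \<le> m b" "m b \<le> 1" for b
  proof -
    show "0 \<le> m b" unfolding m_def using Suc.prems by (simp add: sum_nonneg)
    have "(\<Sum>x\<in>?Q. f (b # x)) \<le> (\<Sum>x\<in>?Q. 1)" using Suc.prems by (intro sum_mono) auto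
    then show "m b \<le> 1" unfolding m_def by (simp add: card_cube)
  qed
  have var0: "0 \<le> var_fn (m b)" for b using m01[of b] by (simp add: var_fn_def)
  have grad: "sqrt ((u b x)\<^sup>2 + (v b x)\<^sup>2) = sqrt ((var_fn (f (b # x)))\<^sup>2 + up_grad_sq (Suc n) f (b # x))" for b x
  proof -
    have "up_grad_sq (Suc n) f (b # x) = (v b x)\<^sup>2 + up_grad_sq n (\<lambda>x. f (b # x)) x"
      unfolding up_grad_sq_def v_def by (subst sum.lessThan_Suc_shift) simp
    moreover have "(u b x)\<^sup>2 = (var_fn (f (b # x)))\<^sup>2 + up_grad_sq n (\<lambda>x. f (b # x)) x"
      unfolding u_def using up_grad_sq_nonneg by simp
    ultimately show ?thesis by (simp add: add_ac)
  qed
  have half: "sqrt ((var_fn (m b))\<^sup>2 + (max 0 (m (\<not> b) - m b))\<^sup>2)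
      \<le> (\<Sum>x\<in>?Q. sqrt ((u b x)\<^sup>2 + (v b x)\<^sup>2)) / 2 ^ n" for b
  proof -
    have 1: "var_fn (m b) \<le> (\<Sum>x\<in>?Q. u b x) / 2 ^ n"
      unfolding m_def u_def by (rule Suc.IH) (use Suc.prems in auto)
    have "m (\<not> b) - m b = (\<Sum>x\<in>?Q. f ((\<not> b) # x) - f (b # x)) / 2 ^ n"
      unfolding m_def by (simp add: sum_subtractf diff_divide_distrib)
    also have "\<dots> \<le> (\<Sum>x\<in>?Q. v b x) / 2 ^ n"
      by (intro divide_right_mono sum_mono) (auto simp: v_def)
    finally have 2: "max 0 (m (\<not> b) - m b) \<le> (\<Sum>x\<in>?Q. v b x) / 2 ^ n"
      by (simp add: v_def sum_nonneg)
    have "sqrt ((var_fn (m b))\<^sup>2 + (max 0 (m (\<not> b) - m b))\<^sup>2)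
        \<le> sqrt (((\<Sum>x\<in>?Q. u b x) / 2 ^ n)\<^sup>2 + ((\<Sum>x\<in>?Q. v b x) / 2 ^ n)\<^sup>2)"
      using 1 2 var0 by (intro real_sqrt_le_mono add_mono power_mono) auto
    also have "\<dots> = sqrt (((\<Sum>x\<in>?Q. u b x)\<^sup>2 + (\<Sum>x\<in>?Q. v b x)\<^sup>2) / (2 ^ n)\<^sup>2)"
      by (simp add: power_divide add_divide_distrib)
    also have "\<dots> = sqrt ((\<Sum>x\<in>?Q. u b x)\<^sup>2 + (\<Sum>x\<in>?Q. v b x)\<^sup>2) / 2 ^ n"
      by (simp add: real_sqrt_divide)
    also have "\<dots> \<le> (\<Sum>x\<in>?Q. sqrt ((u b x)\<^sup>2 + (v b x)\<^sup>2)) / 2 ^ n"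
      by (intro divide_right_mono sqrt_sum_squares_le) simp
    finally show ?thesis .
  qed
  have "(\<Sum>x | length x = Suc n. f x) / 2 ^ Suc n = (m True + m False) / 2"
    unfolding sum_cube_Suc m_def by (simp add: field_simps)
  then have "var_fn ((\<Sum>x | length x = Suc n. f x) / 2 ^ Suc n) \<le>
      (sqrt ((var_fn (m True))\<^sup>2 + (max 0 (m False - m True))\<^sup>2)
       + sqrt ((var_fn (m False))\<^sup>2 + (max 0 (m True - m False))\<^sup>2)) / 2"
    by (simp only:) (intro two_point m01)
  also have "\<dots> \<le> ((\<Sum>x\<in>?Q. sqrt ((u True x)\<^sup>2 + (v True x)\<^sup>2)) / 2 ^ n
      + (\<Sum>x\<in>?Q. sqrt ((u False x)\<^sup>2 + (v False x)\<^sup>2)) / 2 ^ n) / 2"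
    using half[of True] half[of False] by (intro divide_right_mono add_mono) simp_all
  also have "\<dots> = (\<Sum>x | length x = Suc n. sqrt ((var_fn (f x))\<^sup>2 + up_grad_sq (Suc n) f x)) / 2 ^ Suc n"
    unfolding sum_cube_Suc grad by (simp add: field_simps)
  finally show ?case .
qed

text \<open>For an indicator function the gradient vanishes off the outer vertex boundary, and there it is
  at most \<open>sqrt n\<close>.\<close>
lemma cube_vertex_isoperimetry:
  assumes C: "C \<subseteq> {x. length x = n}"
  shows "card C * (1 - card C / 2 ^ n)
    \<le> sqrt n * card {x. length x = n \<and> x \<notin> C \<and> (\<exists>i<n. flip x i \<in> C)}" (is "_ \<le> sqrt n * card ?B")
proof -
  let ?f = "\<lambda>x. if x \<in> C then 1 else 0 :: real"
  have sum: "(\<Sum>x | length x = n. ?f x) = card C"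
    using C finite_cube[of n] by (simp add: sum.If_cases Int_absorb1)
  have "var_fn (card C / 2 ^ n)
      \<le> (\<Sum>x | length x = n. sqrt ((var_fn (?f x))\<^sup>2 + up_grad_sq n ?f x)) / 2 ^ n"
    using one_sided_bobkov[of ?f n] unfolding sum by simp
  also have "(\<Sum>x | length x = n. sqrt ((var_fn (?f x))\<^sup>2 + up_grad_sq n ?f x))
      \<le> (\<Sum>x | length x = n. if x \<in> ?B then sqrt n else 0)"
  proof (rule sum_mono)
    fix x :: "bool list" assume x: "x \<in> {x. length x = n}"
    have v: "var_fn (?f x) = 0" by (simp add: var_fn_def)
    show "sqrt ((var_fn (?f x))\<^sup>2 + up_grad_sq n ?f x) \<le> (if x \<in> ?B then sqrt n else 0)"
    proof (cases "x \<in> ?B")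
      case True
      have "up_grad_sq n ?f x \<le> (\<Sum>i<n. 1)" unfolding up_grad_sq_def by (intro sum_mono) auto
      then show ?thesis using True unfolding v by simp
    next
      case False
      then have "up_grad_sq n ?f x = 0"
        unfolding up_grad_sq_def using x by (intro sum.neutral) auto
      then show ?thesis using False unfolding v by simp
    qed
  qed
  also have "(\<Sum>x | length x = n. if x \<in> ?B then sqrt n else 0) = sqrt n * card ?B"
  proof -
    have "{x. length x = n} \<inter> ?B = ?B" by auto
    then show ?thesis using finite_cube[of n] by (simp only: sum.If_cases Collect_mem_eq) simp
  qed
  finally have "var_fn (card C / 2 ^ n) \<le> sqrt n * card ?B / 2 ^ n"
    by (simp add: divide_right_mono)
  then have "card C * (1 - card C / 2 ^ n) / 2 ^ n \<le> sqrt n * card ?B / 2 ^ n"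
    by (simp add: var_fn_def)
  then show ?thesis by (simp only: divide_le_cancel) simp
qed

lemma inj_on_tl_parity: "inj_on tl (parity_class p (Suc n))"
proof (rule inj_onI)
  fix x y assume "x \<in> parity_class p (Suc n)" "y \<in> parity_class p (Suc n)" and eq: "tl x = tl y"
  then obtain a b z where xy: "x = a # z" "y = b # z"
    and par: "odd (count_list x True) = p" "odd (count_list y True) = p"
    unfolding parity_class_def by (cases x; cases y) auto
  show "x = y" using par unfolding xy by (cases a; cases b) simp_all
qed

text \<open>Deleting the first coordinate identifies both classes with the cube of dimension \<open>n - 1\<close>. The
  neighbourhood of a set then becomes the set together with its outer vertex boundary, so vertex
  isoperimetry gives expansion.\<close>
lemma parity_isoperimetry:
  assumes A: "A \<subseteq> parity_class p n" and half: "2 * card A \<le> 2 ^ (n - 1)" and n: "n > 0"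
  shows "real (card A) \<le> 2 * sqrt n * (real (card (\<Union>u\<in>A. cube_nb u)) - real (card A))"
proof -
  obtain k where k: "n = Suc k" using n by (cases n) auto
  let ?N = "\<Union>u\<in>A. cube_nb u"
  let ?C = "tl ` A"
  let ?B = "{x. length x = k \<and> x \<notin> ?C \<and> (\<exists>i<k. flip x i \<in> ?C)}"
  have finA: "finite A" by (rule finite_subset[OF A finite_parity_class])
  have CQ: "?C \<subseteq> {x. length x = k}" using A by (auto simp: parity_class_def k)
  have cC: "card ?C = card A" using inj_on_subset[OF inj_on_tl_parity] A k by (intro card_image) blast
  have lift: "\<exists>b. b # y \<in> A" if y: "y \<in> ?C" for y
  proof -
    obtain x where x: "x \<in> A" "y = tl x" using y by blast
    then have "length x = Suc k" using A k by (auto simp: parity_class_def)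
    then have "hd x # y = x" using x by (cases x) auto
    then show ?thesis using x by metis
  qed
  have sub: "?C \<union> ?B \<subseteq> tl ` ?N"
  proof (intro Un_least subsetI)
    fix y assume "y \<in> ?C"
    then obtain b where "b # y \<in> A" using lift by blast
    moreover have "(\<not> b) # y \<in> cube_nb (b # y)"
      unfolding cube_nb_eq by (rule image_eqI[of _ _ 0]) auto
    ultimately show "y \<in> tl ` ?N" by force
  next
    fix y assume "y \<in> ?B"
    then obtain i where i: "length y = k" "i < k" "flip y i \<in> ?C" by auto
    then obtain b where b: "b # flip y i \<in> A" using lift by blast
    have "b # y \<in> cube_nb (b # flip y i)"
      unfolding cube_nb_eq by (rule image_eqI[of _ _ "Suc i"]) (use i in auto)
    then show "y \<in> tl ` ?N" using b by force
  qed
  have finN: "finite ?N" using finA by (simp add: cube_nb_eq)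
  have finB: "finite ?B" by (rule finite_subset[OF _ finite_cube[of k]]) auto
  have "card A + card ?B = card (?C \<union> ?B)"
    using finA finB cC by (subst card_Un_disjoint) auto
  also have "\<dots> \<le> card (tl ` ?N)" using sub finN by (intro card_mono) auto
  also have "\<dots> \<le> card ?N" by (rule card_image_le[OF finN])
  finally have B: "real (card ?B) \<le> real (card ?N) - card A" by linarith
  have "real (2 * card A) \<le> real (2 ^ k)" using half k by (simp only: of_nat_le_iff) simp
  then have "card A / 2 ^ k \<le> (1/2 :: real)" by (simp add: field_simps)
  then have "card A * (1 / 2) \<le> card A * (1 - card A / 2 ^ k :: real)" by (intro mult_left_mono) auto
  also have "\<dots> \<le> sqrt k * card ?B" using cube_vertex_isoperimetry[OF CQ] unfolding cC .
  also have "\<dots> \<le> sqrt n * (real (card ?N) - card A)" using B k by (intro mult_mono) auto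
  finally show ?thesis by simp
qed

lemma card_parity_class: "card (parity_class p (Suc n)) = 2 ^ n"
proof -
  have "tl ` parity_class p (Suc n) = {x. length x = n}"
  proof
    show "{x. length x = n} \<subseteq> tl ` parity_class p (Suc n)"
    proof
      fix x :: "bool list" assume "x \<in> {x. length x = n}"
      then have "(odd (count_list x True) \<noteq> p) # x \<in> parity_class p (Suc n)"
        by (auto simp: parity_class_def)
      then show "x \<in> tl ` parity_class p (Suc n)" by force
    qed
  qed (auto simp: parity_class_def)
  then show ?thesis using card_image[OF inj_on_tl_parity[of p n]] card_cube[of n] by simp
qed

section \<open>Total weight of polymers\<close>

text \<open>An upper bound for the size of the approximating set \<open>T\<close> divided by \<open>t\<close>, for the choice
  \<open>\<phi> = d powr (2/3)\<close> and \<open>\<psi> = d powr (5/6)\<close> and given that \<open>a \<le> 2 * sqrt d * t\<close>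
  and \<open>d \<le> 2 * t\<close>. It has
  order \<open>ln d / d powr (1/6)\<close>.\<close>
definition approx_rate :: "nat \<Rightarrow> real" where
  "approx_rate d = 2 * sqrt d * ln d / d powr (2/3) + 2 / d + (2 * sqrt d + 1) / d
     + 2 * d powr (2/3) / d powr (5/6)"

text \<open>The numerical conditions on the dimension that the estimates below use.\<close>
definition large_dim :: "nat \<Rightarrow> bool" where
  "large_dim d \<longleftrightarrow> d \<ge> 3 \<and> d powr (2/3) \<le> d / 2 \<and> d powr (5/6) \<le> d / 2 \<and>
    12 * ln d * approx_rate d - (2/3) / (10 * ln d) \<le> - 1 / (20 * ln d) \<and>
    12 * ln d * approx_rate d + (2 * sqrt d + 2) / d
      + 2 * ln d * (1 / (10 * ln d) + 2 * (d powr (2/3) + d powr (5/6)) / d) - 2/3 \<le> - 1 / (20 * ln d) \<and>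
    4 * log 2 d + 1 - 7 * real d / 18 \<le> - real d / 4 \<and>
    17 + 4 * log 2 d - d powr (2/5) / 3 \<le> - 16"

lemma eventually_large_dim: "eventually large_dim sequentially"
proof -
  have "eventually (\<lambda>d::nat. d \<ge> 3) sequentially" by (rule eventually_ge_at_top)
  moreover have "eventually (\<lambda>d::nat. d powr (2/3) \<le> d / 2) sequentially" by real_asymp
  moreover have "eventually (\<lambda>d::nat. d powr (5/6) \<le> d / 2) sequentially" by real_asymp
  moreover have "eventually (\<lambda>d::nat.
      12 * ln d * approx_rate d - (2/3) / (10 * ln d) \<le> - 1 / (20 * ln d)) sequentially"
    unfolding approx_rate_def by real_asymp
  moreover have "eventually (\<lambda>d::nat. 12 * ln d * approx_rate d + (2 * sqrt d + 2) / d
      + 2 * ln d * (1 / (10 * ln d) + 2 * (d powr (2/3) + d powr (5/6)) / d) - 2/3 \<le> - 1 / (20 * ln d)) sequentially"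
    unfolding approx_rate_def by real_asymp
  moreover have "eventually (\<lambda>d::nat. 4 * log 2 d + 1 - 7 * real d / 18 \<le> - real d / 4) sequentially"
    by real_asymp
  moreover have "eventually (\<lambda>d::nat. 17 + 4 * log 2 d - d powr (2/5) / 3 \<le> - 16) sequentially"
    by real_asymp
  ultimately show ?thesis
    unfolding large_dim_def by eventually_elim blast
qed

text \<open>A bound for the total weight of the polymers with at least two vertices; the first summand
  comes from those with at most \<open>d powr (8/5)\<close> vertices.\<close>
definition polymer_error :: "nat \<Rightarrow> real" where
  "polymer_error d = d ^ 2 * 2 powr (- real d / 2) + 8 ^ d * exp (- (d powr (11/10)) / (40 * ln d))"

lemma polymer_error_tendsto: "polymer_error \<longlonglongrightarrow> 0"
  unfolding polymer_error_def by real_asymp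


text \<open>The properties of the hypercube on which the estimate of the polymers rests.\<close>
locale expander = bireg +
  assumes codegree: "u \<in> L \<Longrightarrow> u' \<in> L \<Longrightarrow> u \<noteq> u' \<Longrightarrow> card (nb u \<inter> nb u') \<le> 2"
    and isoperimetry: "A \<subseteq> L \<Longrightarrow> 2 * card A \<le> card L \<Longrightarrow>
      real (card A) \<le> 2 * sqrt d * (real (card (Nb A)) - real (card A))"
    and card_L: "card L = 2 ^ (d - 1)"
begin

text \<open>Large polymers. By isoperimetry \<open>t\<close> is at least \<open>a / (2 * sqrt d)\<close>. The set \<open>T\<close> has
  at most \<open>t * approx_rate d\<close> elements up to rounding and each of them contributes a factor
  \<open>d ^ 12\<close> to the number of choices; this is beaten by the gain \<open>2 powr (- \<kappa> * t)\<close> with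
  \<open>\<kappa> = 1 / (10 * ln d)\<close>. In the second alternative of \<open>container_sum\<close>, \<open>y = 1 / d\<^sup>2\<close>.\<close>
lemma family_weight_le:
  assumes l: "l \<ge> 1" and d: "large_dim d" and half: "2 * a \<le> card L" and a: "d powr (8/5) \<le> a"
  shows "(\<Sum>A\<in>family a g. wt l A) \<le> 2 ^ d * exp (- (d powr (11/10)) / (40 * ln d))"
proof (cases "family a g = {}")
  case True
  then show ?thesis by simp
next
  case False
  then obtain A where A: "A \<subseteq> L" "card (cl A) = a" "card (Nb A) = g" by (auto simp: family_def)
  define t where "t = real g - real a"
  define \<phi> where "\<phi> = d powr (2/3)"
  define \<psi> where "\<psi> = d powr (5/6)"
  have d3: "d \<ge> 3" and phi: "\<phi> \<le> d / 2" and psi: "\<psi> \<le> d / 2"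
    and E1: "12 * ln d * approx_rate d - (2/3) / (10 * ln d) \<le> - 1 / (20 * ln d)"
    and E2: "12 * ln d * approx_rate d + (2 * sqrt d + 2) / d
      + 2 * ln d * (1 / (10 * ln d) + 2 * (\<phi> + \<psi>) / d) - 2/3 \<le> - 1 / (20 * ln d)"
    using d unfolding large_dim_def \<phi>_def \<psi>_def by blast+
  have dpos: "real d > 0" and lnpos: "ln d > 0" using d3 by auto
  have pos: "\<phi> > 0" "\<psi> > 0" using dpos by (simp_all add: \<phi>_def \<psi>_def)
  have at: "a \<le> 2 * sqrt d * t"
    using isoperimetry[OF cl_subset[of A]] half A Nb_cl[OF A(1)] by (simp add: t_def)
  have "d powr (11/10) * (2 * sqrt d) = 2 * d powr (8/5)"
    using dpos by (simp add: powr_half_sqrt[symmetric] powr_add[symmetric])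
  also have "\<dots> \<le> 2 * (2 * sqrt d * t)" using a at by linarith
  also have "\<dots> = 2 * t * (2 * sqrt d)" by simp
  finally have "d powr (11/10) * (2 * sqrt d) \<le> 2 * t * (2 * sqrt d)" .
  then have t_ge: "d powr (11/10) \<le> 2 * t" using dpos by (simp only: mult_le_cancel_right) simp
  have "d powr 1 \<le> d powr (11/10)" using d3 by (intro powr_mono) auto
  then have t_d: "d \<le> 2 * t" using t_ge dpos by simp
  then have t0: "t > 0" using dpos by linarith
  define M where "M = a * ln d / \<phi> + 1 + g / d + 2 * t * \<phi> / \<psi>"
  define m where "m = nat \<lceil>M\<rceil>"
  have M1: "M \<ge> 1" unfolding M_def using lnpos pos t0 by simp
  have m: "m > 0" "M \<le> m" "real (m - 1) \<le> M" unfolding m_def using M1 by linarith+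
  have "M \<le> t * approx_rate d"
  proof -
    have "a * (ln d / \<phi>) \<le> 2 * sqrt d * t * (ln d / \<phi>)"
      using at lnpos pos by (intro mult_right_mono) auto
    moreover have "1 \<le> t * (2 / d)" using t_d dpos by (simp add: field_simps)
    moreover have "g / d \<le> t * ((2 * sqrt d + 1) / d)"
      using at dpos unfolding t_def by (simp add: field_simps)
    ultimately show ?thesis unfolding M_def approx_rate_def \<phi>_def[symmetric] \<psi>_def[symmetric]
      by (simp add: algebra_simps)
  qed
  then have "12 * ln d * real (m - 1) \<le> 12 * ln d * (t * approx_rate d)"
    using m(3) lnpos by (intro mult_left_mono) auto
  then have mexp: "12 * ln d * real (m - 1) \<le> t * (12 * ln d * approx_rate d)" by (simp add: mult_ac)
  have pw: "real (card L * (d ^ 6) ^ (2 * (m - 1))) = 2 ^ (d - 1) * exp (12 * ln d * real (m - 1))"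
  proof -
    have "(real d ^ 6) ^ (2 * (m - 1)) = real d ^ (12 * (m - 1))" by (simp flip: power_mult add: mult_ac)
    also have "\<dots> = exp (ln d) ^ (12 * (m - 1))" using dpos by simp
    also have "\<dots> = exp (12 * ln d * real (m - 1))" by (simp flip: exp_of_nat_mult add: mult_ac)
    finally show ?thesis by (simp add: card_L)
  qed
  define \<kappa> where "\<kappa> = 1 / (10 * ln d)"
  have kap: "\<kappa> \<ge> 0" using lnpos by (simp add: \<kappa>_def)
  have ln2: "ln 2 \<ge> (2/3 :: real)" by (rule ln2_ge_two_thirds)
  define Y where "Y = - t / (20 * ln d)"
  have term1: "exp (12 * ln d * real (m - 1)) * 2 powr (- (\<kappa> * t)) \<le> exp Y"
  proof -
    have "\<kappa> * t * ln 2 \<ge> \<kappa> * t * (2/3)" using ln2 kap t0 by (intro mult_left_mono) auto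
    then have "12 * ln d * real (m - 1) - \<kappa> * t * ln 2 \<le> t * (12 * ln d * approx_rate d - (2/3) / (10 * ln d))"
      using mexp by (simp add: \<kappa>_def algebra_simps)
    also have "\<dots> \<le> t * (- 1 / (20 * ln d))" using E1 t0 by (intro mult_left_mono) auto
    finally show ?thesis unfolding powr_def by (simp add: Y_def flip: exp_add)
  qed
  have term2: "exp (12 * ln d * real (m - 1)) * (exp (1 / real d ^ 2 * (d * (a + 2 * t)))
      * (1 / real d ^ 2) powr (- (\<kappa> * t + 2 * t * (\<phi> + \<psi>) / d)) * 2 powr (- t)) \<le> exp Y"
  proof -
    have y: "ln (1 / real d ^ 2) = - 2 * ln d" using dpos by (simp add: ln_div ln_realpow)
    have e1: "1 / real d ^ 2 * (d * (a + 2 * t)) \<le> t * ((2 * sqrt d + 2) / d)"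
      using at dpos by (simp add: power2_eq_square field_simps)
    have e2: "t * ln 2 \<ge> t * (2/3)" using ln2 t0 by (intro mult_left_mono) auto
    have "12 * ln d * real (m - 1) + (1 / real d ^ 2 * (d * (a + 2 * t))
        + 2 * ln d * (\<kappa> * t + 2 * t * (\<phi> + \<psi>) / d) - t * ln 2)
      \<le> t * (12 * ln d * approx_rate d) + (t * ((2 * sqrt d + 2) / d)
        + 2 * ln d * (\<kappa> * t + 2 * t * (\<phi> + \<psi>) / d) - t * (2/3))"
      using mexp e1 e2 by linarith
    also have "\<dots> = t * (12 * ln d * approx_rate d + (2 * sqrt d + 2) / d
      + 2 * ln d * (1 / (10 * ln d) + 2 * (\<phi> + \<psi>) / d) - 2/3)"
      by (simp add: \<kappa>_def algebra_simps)
    also have "\<dots> \<le> t * (- 1 / (20 * ln d))" using E2 t0 by (intro mult_left_mono) auto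
    finally have "12 * ln d * real (m - 1) + (1 / real d ^ 2 * (d * (a + 2 * t))
        + 2 * ln d * (\<kappa> * t + 2 * t * (\<phi> + \<psi>) / d) - t * ln 2) \<le> Y" by (simp add: Y_def)
    moreover have "(1 / real d ^ 2) powr (- z) = exp (2 * ln d * z)" for z
      using dpos unfolding powr_def y by simp
    moreover have "2 powr (- t) = exp (- t * ln 2)" by (simp add: powr_def)
    ultimately show ?thesis by (simp only: exp_add[symmetric]) simp
  qed
  have "(\<Sum>A\<in>family a g. wt l A) \<le> real (card L * (d ^ 6) ^ (2 * (m - 1))) *
    (2 powr (- (\<kappa> * t)) + exp (1 / real d ^ 2 * (d * (a + 2 * t)))
      * (1 / real d ^ 2) powr (- (\<kappa> * t + 2 * t * (\<phi> + \<psi>) / d)) * 2 powr (- t))"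
    using container_sum[OF l pos(1) phi pos(2) psi _ _ kap t_def m(1) m(2)[unfolded M_def], of "1 / real d ^ 2"]
      d3 dpos by simp
  also have "\<dots> \<le> 2 ^ (d - 1) * (exp Y + exp Y)"
    unfolding pw
  proof -
    have "c * e * (x + z) \<le> c * (w + w)" if "e * x \<le> w" "e * z \<le> w" "c \<ge> 0" for c e x z w :: real
      using mult_left_mono[OF add_mono[OF that(1,2)] that(3)] by (simp add: distrib_left mult.assoc)
    from this[OF term1 term2, of "2 ^ (d - 1)"]
    show "2 ^ (d - 1) * exp (12 * ln d * real (m - 1)) * (2 powr (- (\<kappa> * t))
      + exp (1 / real d ^ 2 * (d * (a + 2 * t)))
      * (1 / real d ^ 2) powr (- (\<kappa> * t + 2 * t * (\<phi> + \<psi>) / d)) * 2 powr (- t)) \<le> 2 ^ (d - 1) * (exp Y + exp Y)"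
      by simp
  qed
  also have "\<dots> = 2 ^ d * exp Y" using d3 by (cases d) auto
  also have "exp Y \<le> exp (- (d powr (11/10)) / (40 * ln d))"
    using t_ge lnpos unfolding Y_def by (simp add: field_simps)
  finally show ?thesis by simp
qed

text \<open>Sets with between two and \<open>d powr (8/5)\<close> vertices have neighbourhoods so large that the crude
  count of linked sets suffices.\<close>
lemma small_set_weight_le:
  assumes l: "l \<ge> 1" and d: "large_dim d" and s2: "2 \<le> s" and s: "s \<le> d powr (8/5)"
  shows "(\<Sum>A | A \<subseteq> L \<and> A \<noteq> {} \<and> linked near A \<and> card A = s. wt l A) \<le> 2 powr (- real d / 2)"
proof -
  let ?F = "{A. A \<subseteq> L \<and> A \<noteq> {} \<and> linked near A \<and> card A = s}"
  let ?G = "{A. A \<subseteq> L \<and> A \<noteq> {} \<and> linked near A \<and> card A \<le> s}"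
  have d3: "d \<ge> 3" and E3: "4 * log 2 d + 1 - 7 * real d / 18 \<le> - real d / 4"
    and E4: "17 + 4 * log 2 d - d powr (2/5) / 3 \<le> - 16"
    using d unfolding large_dim_def by blast+
  have dpos: "real d > 0" using d3 by simp
  define q where "q = real s * real d ^ 2 / (d + 2 * real s)"
  have wt_le: "wt l A \<le> 2 powr (s - q)" if A: "A \<in> ?F" for A
  proof -
    have AL: "A \<subseteq> L" and cA: "card A = s" using A by auto
    have "q \<le> card (Nb A)"
      using expansion_from_codegree[OF codegree AL] dpos unfolding q_def cA
      by (simp add: field_simps)
    have ge: "s \<le> card (Nb A)" using card_Nb_ge[OF AL] cA by simp
    have "wt l A \<le> (1 + l) ^ s / (1 + l) ^ card (Nb A)"
      unfolding wt_def cA using l by (intro divide_right_mono power_mono) auto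
    also have "\<dots> = (1 + l) powr (real s - card (Nb A))"
      using l by (simp add: powr_diff powr_realpow)
    also have "\<dots> \<le> 2 powr (real s - card (Nb A))" using l ge by (intro powr_mono2') auto
    also have "\<dots> \<le> 2 powr (s - q)" using \<open>q \<le> card (Nb A)\<close> by (intro powr_mono) auto
    finally show ?thesis .
  qed
  have finG: "finite ?G" by (rule finite_subset[of _ "Pow L"]) (auto simp: finite_L)
  have "card ?F \<le> card ?G" using finG by (intro card_mono) auto
  also have "\<dots> \<le> card L * (d ^ 2) ^ (2 * (s - 1))"
    by (rule card_linked_sets_le[OF finite_L]) (use s2 in \<open>auto intro: card_near_le near_sym near_refl\<close>)
  also have "\<dots> = 2 ^ (d - 1) * d ^ (4 * (s - 1))" by (simp add: card_L flip: power_mult)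
  also have "\<dots> \<le> 2 ^ d * d ^ (4 * s)" using d3 by (intro mult_mono power_increasing) auto
  finally have "real (card ?F) \<le> real (2 ^ d * d ^ (4 * s))" by (rule of_nat_mono)
  also have "\<dots> = 2 powr d * 2 powr (4 * real s * log 2 d)"
  proof -
    have "2 powr (4 * real s * log 2 d) = (2 powr log 2 d) powr (4 * s)" by (simp add: powr_powr mult_ac)
    also have "\<dots> = real d ^ (4 * s)" using dpos by (simp flip: powr_realpow)
    finally show ?thesis by (simp add: powr_realpow)
  qed
  finally have cF: "card ?F \<le> 2 powr (d + 4 * real s * log 2 d)" by (simp add: powr_add)
  have "(\<Sum>A\<in>?F. wt l A) \<le> (\<Sum>A\<in>?F. 2 powr (s - q))" by (intro sum_mono wt_le)
  also have "\<dots> = card ?F * 2 powr (s - q)" by simp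
  also have "\<dots> \<le> 2 powr (d + 4 * real s * log 2 d) * 2 powr (s - q)" using cF by (intro mult_right_mono) auto
  also have "\<dots> = 2 powr (d + 4 * real s * log 2 d + (s - q))" by (simp add: powr_add)
  also have "\<dots> \<le> 2 powr (- real d / 2)"
  proof (intro powr_mono)
    show "d + 4 * real s * log 2 d + (s - q) \<le> - real d / 2"
    proof (cases "16 * s \<le> d")
      case True
      have "s * (8 * real d / 9) \<le> q"
      proof -
        have "real d + 2 * real s \<le> 9 * real d / 8" using True by linarith
        then have "s * (8 * real d / 9) * (d + 2 * real s) \<le> s * (8 * real d / 9) * (9 * real d / 8)"
          by (intro mult_left_mono) auto
        then show ?thesis unfolding q_def using dpos by (simp add: field_simps power2_eq_square)
      qed
      moreover have "real d \<le> s * (d / 2)"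
        using mult_right_mono[of 2 "real s" "d / 2"] s2 by simp
      ultimately have "d + 4 * real s * log 2 d + (s - q) \<le> s * (d / 2) + 4 * real s * log 2 d + s - s * (8 * real d / 9)"
        by linarith
      also have "\<dots> = s * (4 * log 2 d + 1 - 7 * real d / 18)" by (simp add: field_simps)
      also have "\<dots> \<le> s * (- real d / 4)" using E3 by (intro mult_left_mono) auto
      also have "\<dots> \<le> - real d / 2" using mult_right_mono[of 2 "real s" "d / 4"] s2 by simp
      finally show ?thesis .
    next
      case False
      then have d16: "real d \<le> 16 * real s" by linarith
      have "s * (d powr (2/5) / 3) \<le> q"
      proof -
        have "d powr 1 \<le> d powr (8/5)" using d3 by (intro powr_mono) auto
        then have "real d + 2 * real s \<le> 3 * d powr (8/5)" using s dpos by simp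
        then have "s * (d powr (2/5) / 3) * (d + 2 * real s) \<le> s * (d powr (2/5) / 3) * (3 * d powr (8/5))"
          by (intro mult_left_mono) auto
        also have "\<dots> = s * (d powr (2/5) * d powr (8/5))" by simp
        also have "d powr (2/5) * d powr (8/5) = d powr 2" by (simp flip: powr_add)
        also have "d powr 2 = real d ^ 2" using dpos by (simp add: powr_numeral)
        finally show ?thesis unfolding q_def using dpos by (simp add: field_simps)
      qed
      with d16 have "d + 4 * real s * log 2 d + (s - q) \<le> 16 * real s + 4 * real s * log 2 d + s - s * (d powr (2/5) / 3)"
        by linarith
      also have "\<dots> = s * (17 + 4 * log 2 d - d powr (2/5) / 3)" by (simp add: field_simps)
      also have "\<dots> \<le> real s * (- 16)" using E4 by (intro mult_left_mono) auto
      also have "\<dots> \<le> - real d / 2" using d16 by simp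
      finally show ?thesis .
    qed
  qed simp
  finally show ?thesis .
qed

text \<open>The leading term comes from the \<open>2 ^ (d - 1)\<close> polymers with a single vertex.\<close>
theorem polymer_sum_le:
  assumes l: "l \<ge> 1" and d: "large_dim d"
  shows "(\<Sum>A\<in>polymers. wt l A) \<le> 2 ^ (d - 1) * l / (1 + l) ^ d + polymer_error d"
proof -
  define F1 where "F1 = (\<lambda>u. {u}) ` L"
  define F2 where "F2 s = {A. A \<subseteq> L \<and> A \<noteq> {} \<and> linked near A \<and> card A = s}" for s
  define S where "S = {s::nat. 2 \<le> s \<and> s \<le> d powr (8/5)}"
  define P where "P = {(a::nat, g::nat). 2 * a \<le> card L \<and> d powr (8/5) \<le> a \<and> g \<le> card L}"
  have d3: "d \<ge> 3" using d unfolding large_dim_def by blast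
  have wt0: "wt l A \<ge> 0" for A using l by (intro wt_nonneg) auto
  have S_sub: "S \<subseteq> {2..d^2}"
  proof
    fix s assume s: "s \<in> S"
    then have "real s \<le> d powr (8/5)" by (simp add: S_def)
    also have "\<dots> \<le> d powr 2" using d3 by (intro powr_mono) auto
    also have "\<dots> = real (d ^ 2)" using d3 by (simp add: powr_numeral)
    finally show "s \<in> {2..d^2}" using s by (simp only: of_nat_le_iff) (simp add: S_def)
  qed
  have finS: "finite S" by (rule finite_subset[OF S_sub]) simp
  have cS: "card S \<le> d ^ 2" using card_mono[OF _ S_sub] by simp
  have P_sub: "P \<subseteq> {..card L} \<times> {..card L}" by (auto simp: P_def)
  have finP: "finite P" by (rule finite_subset[OF P_sub]) simp
  have "card P \<le> (card L + 1) ^ 2"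
    using card_mono[OF _ P_sub] by (simp add: card_cartesian_product power2_eq_square)
  also have "\<dots> \<le> (2 ^ d) ^ 2"
  proof -
    have "card L + 1 \<le> 2 * 2 ^ (d - 1)" unfolding card_L using one_le_power[of "2::nat" "d - 1"] by linarith
    also have "\<dots> = 2 ^ d" using d3 by (cases d) auto
    finally show ?thesis by (rule power_mono) simp
  qed
  finally have "real (card P) \<le> real ((2 ^ d) ^ 2)" by (rule of_nat_mono)
  then have cP: "real (card P) \<le> 4 ^ d" by (simp flip: power_mult_distrib power_mult add: power2_eq_square)
  have fin1: "finite F1" by (simp add: F1_def finite_L)
  have fin2: "finite (F2 s)" for s by (rule finite_subset[of _ "Pow L"]) (auto simp: F2_def finite_L)
  have cover: "polymers \<subseteq> F1 \<union> (\<Union>s\<in>S. F2 s) \<union> (\<Union>p\<in>P. family (fst p) (snd p))"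
  proof
    fix A assume "A \<in> polymers"
    then have A: "A \<subseteq> L" "A \<noteq> {}" "linked near A" "2 * card (cl A) \<le> card L" by (auto simp: polymers_def)
    have finA: "finite A" by (rule finite_subset_L[OF A(1)])
    then have cA: "card A \<noteq> 0" using A(2) by simp
    consider "card A = 1" | "2 \<le> card A" "card A \<le> d powr (8/5)" | "d powr (8/5) < card A"
      using cA by linarith
    then show "A \<in> F1 \<union> (\<Union>s\<in>S. F2 s) \<union> (\<Union>p\<in>P. family (fst p) (snd p))"
    proof cases
      case 1
      then obtain u where "A = {u}" by (auto simp: card_1_singleton_iff)
      then show ?thesis using A(1) by (auto simp: F1_def)
    next
      case 2
      then have "card A \<in> S" "A \<in> F2 (card A)" using A by (auto simp: S_def F2_def)
      then show ?thesis by blast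
    next
      case 3
      have "card A \<le> card (cl A)"
        using subset_cl[OF A(1)] finite_subset_L[OF cl_subset] by (intro card_mono)
      moreover have "card (Nb A) \<le> card L"
        unfolding card_L_eq_card_R by (intro card_mono finite_R Nb_subset A(1))
      ultimately have "(card (cl A), card (Nb A)) \<in> P" using 3 A(4) by (simp add: P_def)
      moreover have "A \<in> family (card (cl A)) (card (Nb A))" using A by (simp add: family_def)
      ultimately show ?thesis by force
    qed
  qed
  have un: "sum (wt l) (X \<union> Y) \<le> sum (wt l) X + sum (wt l) Y" if "finite X" "finite Y" for X Y
    using sum.union_inter[OF that, of "wt l"] sum_nonneg[of "X \<inter> Y" "wt l"] wt0 by simp
  have fin2': "finite (\<Union>s\<in>S. F2 s)" using finS fin2 by blast
  have fin3': "finite (\<Union>p\<in>P. family (fst p) (snd p))" using finP finite_family by blast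
  have "(\<Sum>A\<in>polymers. wt l A) \<le> sum (wt l) (F1 \<union> (\<Union>s\<in>S. F2 s) \<union> (\<Union>p\<in>P. family (fst p) (snd p)))"
    using fin1 fin2' fin3' wt0 by (intro sum_mono2 cover) auto
  also have "\<dots> \<le> sum (wt l) F1 + sum (wt l) (\<Union>s\<in>S. F2 s) + sum (wt l) (\<Union>p\<in>P. family (fst p) (snd p))"
    using un[of "F1 \<union> (\<Union>s\<in>S. F2 s)" "\<Union>p\<in>P. family (fst p) (snd p)"] un[of F1 "\<Union>s\<in>S. F2 s"]
      fin1 fin2' fin3' by simp
  also have "sum (wt l) F1 = 2 ^ (d - 1) * l / (1 + l) ^ d"
  proof -
    have "sum (wt l) F1 = (\<Sum>u\<in>L. wt l {u})" unfolding F1_def by (simp add: sum.reindex)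
    also have "\<dots> = (\<Sum>u\<in>L. l / (1 + l) ^ d)"
      by (intro sum.cong refl) (simp add: wt_def Nb_def deg_L)
    finally show ?thesis by (simp add: card_L)
  qed
  also have "sum (wt l) (\<Union>s\<in>S. F2 s) \<le> (\<Sum>s\<in>S. sum (wt l) (F2 s))"
    by (intro sum_UN_le finS fin2 wt0)
  also have "\<dots> \<le> (\<Sum>s\<in>S. 2 powr (- real d / 2))"
    unfolding F2_def by (intro sum_mono small_set_weight_le l d) (auto simp: S_def)
  also have "\<dots> = card S * 2 powr (- real d / 2)" by simp
  also have "\<dots> \<le> d ^ 2 * 2 powr (- real d / 2)"
    using cS by (intro mult_right_mono) (auto simp only: of_nat_le_iff powr_ge_zero)
  also have "sum (wt l) (\<Union>p\<in>P. family (fst p) (snd p)) \<le> (\<Sum>p\<in>P. sum (wt l) (family (fst p) (snd p)))"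
    by (intro sum_UN_le finP finite_family wt0)
  also have "\<dots> \<le> (\<Sum>p\<in>P. 2 ^ d * exp (- (d powr (11/10)) / (40 * ln d)))"
    by (intro sum_mono family_weight_le l d) (auto simp: P_def)
  also have "\<dots> = card P * (2 ^ d * exp (- (d powr (11/10)) / (40 * ln d)))" by simp
  also have "\<dots> \<le> 4 ^ d * (2 ^ d * exp (- (d powr (11/10)) / (40 * ln d)))"
    by (intro mult_right_mono cP) simp
  also have "4 ^ d * (2 ^ d * exp (- (d powr (11/10)) / (40 * ln d))) = 8 ^ d * exp (- (d powr (11/10)) / (40 * ln d))"
    by (simp flip: power_mult_distrib mult.assoc)
  finally show ?thesis unfolding polymer_error_def by (simp add: add_ac)
qed

end

section \<open>The hard-core measure on the hypercube\<close>

lemma expander_cube: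
  assumes n: "n > 0"
  shows "expander (parity_class p n) (parity_class (\<not> p) n) cube_nb n"
proof -
  interpret bireg "parity_class p n" "parity_class (\<not> p) n" cube_nb n by (rule bireg_cube[OF n])
  have card: "card (parity_class p n) = 2 ^ (n - 1)" using card_parity_class[of p "n - 1"] n by simp
  show ?thesis
  proof
    show "card (cube_nb u \<inter> cube_nb u') \<le> 2" if "u \<noteq> u'" for u u'
      by (rule cube_codegree[OF that])
    show "real (card A) \<le> 2 * sqrt n * (real (card (Nb A)) - real (card A))"
      if "A \<subseteq> parity_class p n" "2 * card A \<le> card (parity_class p n)" for A
      using parity_isoperimetry[OF that(1) _ n] that(2) unfolding card Nb_def by simp
  qed (rule card)
qed

lemma even_class_eq: "even_class d = parity_class False d"
  and odd_class_eq: "odd_class d = parity_class True d"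
  by (auto simp: even_class_def odd_class_def parity_class_def cube_vertices_def)

lemma indep_sets_cube_eq:
  assumes "d > 0"
  shows "indep_sets_cube d = {I. bireg.indep (even_class d) (odd_class d) cube_nb I}"
proof -
  interpret bireg "even_class d" "odd_class d" cube_nb d
    using bireg_cube[OF assms, of False] by (simp add: even_class_eq odd_class_eq)
  have V: "cube_vertices d = even_class d \<union> odd_class d"
    by (auto simp: even_class_def odd_class_def)
  show ?thesis
  proof (intro set_eqI iffI)
    fix I assume "I \<in> indep_sets_cube d"
    then have "I \<subseteq> even_class d \<union> odd_class d" "\<And>x y. x \<in> I \<Longrightarrow> y \<in> I \<Longrightarrow> \<not> cube_adj x y"
      unfolding indep_sets_cube_def V by blast+
    then have "indep I" unfolding indep_def cube_nb_def by blast
    then show "I \<in> {I. indep I}" by simp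
  next
    fix I assume "I \<in> {I. indep I}"
    then have I: "I \<subseteq> even_class d \<union> odd_class d" "\<And>u. u \<in> I \<inter> even_class d \<Longrightarrow> cube_nb u \<inter> I = {}"
      unfolding indep_def by blast+
    have "\<not> cube_adj x y" if xy: "x \<in> I" "y \<in> I" for x y
    proof
      assume adj: "cube_adj x y"
      then have y: "y \<in> cube_nb x" and x: "x \<in> cube_nb y" using cube_adj_sym by (auto simp: cube_nb_def)
      consider "x \<in> even_class d" | "x \<in> odd_class d" using I(1) xy by blast
      then show False
      proof cases
        case 1
        then show False using I(2)[of x] xy y by blast
      next
        case 2
        then have "y \<in> even_class d" using nb_R y by blast
        then show False using I(2)[of y] xy x by blast
      qed
    qed
    then show "I \<in> indep_sets_cube d" using I(1) unfolding indep_sets_cube_def V by blast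
  qed
qed

lemma prob_hc:
  assumes "l > 0"
  shows "measure_pmf.prob (hc d l) S = (\<Sum>I | I \<in> indep_sets_cube d \<and> I \<in> S. l ^ card I) / hc_partition d l"
proof -
  have sub: "set_pmf (hc d l) \<subseteq> indep_sets_cube d"
    by (auto simp: set_pmf_iff pmf_hc[OF assms] split: if_splits)
  have "measure_pmf.prob (hc d l) S = measure_pmf.prob (hc d l) (S \<inter> set_pmf (hc d l))"
    by (simp add: measure_Int_set_pmf)
  also have "S \<inter> set_pmf (hc d l) = {I. I \<in> indep_sets_cube d \<and> I \<in> S} \<inter> set_pmf (hc d l)"
    using sub by blast
  also have "measure_pmf.prob (hc d l) \<dots> = measure_pmf.prob (hc d l) {I. I \<in> indep_sets_cube d \<and> I \<in> S}"
    by (simp add: measure_Int_set_pmf)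
  also have "\<dots> = (\<Sum>I | I \<in> indep_sets_cube d \<and> I \<in> S. pmf (hc d l) I)"
    by (rule measure_measure_pmf_finite) (simp add: finite_indep_sets_cube)
  also have "\<dots> = (\<Sum>I | I \<in> indep_sets_cube d \<and> I \<in> S. l ^ card I / hc_partition d l)"
    by (intro sum.cong refl) (simp add: pmf_hc[OF assms])
  finally show ?thesis by (simp add: sum_divide_distrib)
qed

text \<open>The event that the set misses one of the two classes.\<close>
definition one_sided :: "nat \<Rightarrow> bool list set set" where
  "one_sided d = {I. min (card (I \<inter> even_class d)) (card (I \<inter> odd_class d)) = 0}"

lemma one_sided_iff:
  "I \<in> one_sided d \<longleftrightarrow> I \<inter> even_class d = {} \<or> I \<inter> odd_class d = {}"
proof -
  have "finite (I \<inter> even_class d)" "finite (I \<inter> odd_class d)"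
    by (simp_all add: even_class_eq odd_class_eq finite_parity_class)
  moreover have "min a b = 0 \<longleftrightarrow> a = 0 \<or> b = 0" for a b :: nat by linarith
  ultimately show ?thesis by (simp add: one_sided_def)
qed

lemma prob_one_sided_ge:
  assumes l: "l \<ge> 1" and d: "large_dim d"
  shows "1 - 2 * (2 ^ (d - 1) * l / (1 + l) ^ d + polymer_error d) \<le> measure_pmf.prob (hc d l) (one_sided d)"
proof -
  have d0: "d > 0" using d unfolding large_dim_def by simp
  have l0: "l > 0" using l by simp
  interpret E: expander "even_class d" "odd_class d" cube_nb d
    using expander_cube[OF d0, of False] by (simp add: even_class_eq odd_class_eq)
  interpret O: expander "odd_class d" "even_class d" cube_nb d
    using expander_cube[OF d0, of True] by (simp add: even_class_eq odd_class_eq)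
  let ?B = "{I. E.indep I \<and> I \<inter> even_class d \<noteq> {} \<and> I \<inter> odd_class d \<noteq> {}}"
  let ?G = "{I. E.indep I \<and> I \<in> one_sided d}"
  let ?e = "2 ^ (d - 1) * l / (1 + l) ^ d + polymer_error d"
  have indep: "indep_sets_cube d = {I. E.indep I}" by (rule indep_sets_cube_eq[OF d0])
  define Z where "Z = hc_partition d l"
  have Z: "Z > 0" unfolding Z_def by (rule hc_partition_pos[OF l0])
  have Z_eq: "Z = (\<Sum>I | E.indep I. l ^ card I)" by (simp add: Z_def hc_partition_def indep)
  have "(\<Sum>I\<in>?B. l ^ card I) \<le> ((\<Sum>A\<in>E.polymers. E.wt l A) + (\<Sum>A\<in>O.polymers. O.wt l A)) * Z"
    unfolding Z_eq by (rule E.two_sided_weight_le[OF l0])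
  also have "\<dots> \<le> (?e + ?e) * Z"
    using E.polymer_sum_le[OF l d] O.polymer_sum_le[OF l d] Z by (intro mult_right_mono add_mono) auto
  finally have B: "(\<Sum>I\<in>?B. l ^ card I) \<le> 2 * ?e * Z" by (simp only: mult_2)
  have "Z = (\<Sum>I\<in>?G \<union> ?B. l ^ card I)"
    unfolding Z_eq one_sided_iff by (intro sum.cong) auto
  also have "\<dots> = (\<Sum>I\<in>?G. l ^ card I) + (\<Sum>I\<in>?B. l ^ card I)"
    by (rule sum.union_disjoint)
      (auto simp: one_sided_iff intro: finite_subset[OF _ E.finite_indep])
  finally have "Z - 2 * ?e * Z \<le> (\<Sum>I\<in>?G. l ^ card I)" using B by linarith
  then have "(1 - 2 * ?e) * Z \<le> (\<Sum>I\<in>?G. l ^ card I)" by (simp add: left_diff_distrib)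
  moreover have "measure_pmf.prob (hc d l) (one_sided d) = (\<Sum>I\<in>?G. l ^ card I) / Z"
    unfolding prob_hc[OF l0] indep Z_def[symmetric] by simp
  ultimately show ?thesis using Z by (simp add: pos_le_divide_eq)
qed

lemma singleton_weight_le:
  fixes l :: real
  assumes l: "l \<ge> 1" and d: "d \<ge> 2"
  shows "2 ^ (d - 1) * l / (1 + l) ^ d \<le> 1 / (1 + real d * (l - 1) / 4)"
proof -
  obtain k where k: "d = Suc k" using d by (cases d) auto
  have "2 ^ (d - 1) * l / (1 + l) ^ d = (2 / (1 + l)) ^ k * (l / (1 + l))"
    by (simp add: k power_divide)
  also have "\<dots> \<le> (2 / (1 + l)) ^ k * 1" using l by (intro mult_left_mono) auto
  also have "\<dots> = 1 / (1 + (l - 1) / 2) ^ k"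
  proof -
    have "2 / (1 + l) = 1 / (1 + (l - 1) / 2)" using l by (simp add: field_simps)
    then show ?thesis by (simp only: power_one_over mult_1_right)
  qed
  also have "\<dots> \<le> 1 / (1 + real d * (l - 1) / 4)"
  proof (rule divide_left_mono)
    have "real d * (l - 1) / 4 \<le> k * ((l - 1) / 2)"
    proof -
      have "real d \<le> 2 * real k" using k d by simp
      then have "real d * (l - 1) \<le> 2 * real k * (l - 1)" using l by (intro mult_right_mono) auto
      then show ?thesis by simp
    qed
    also have "1 + k * ((l - 1) / 2) \<le> (1 + (l - 1) / 2) ^ k"
      using l by (intro Bernoulli_inequality) auto
    finally show "1 + real d * (l - 1) / 4 \<le> (1 + (l - 1) / 2) ^ k" by simp
  qed (use l in \<open>auto intro!: mult_pos_pos zero_less_power add_pos_nonneg\<close>)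
  finally show ?thesis .
qed

text \<open>The independent sets with exactly one even vertex.\<close>
lemma hc_partition_ge:
  assumes l: "l > 0" and d: "d > 0"
  shows "2 ^ (d - 1) * l * (1 + l) ^ (2 ^ (d - 1) - d) \<le> hc_partition d l"
proof -
  interpret E: expander "even_class d" "odd_class d" cube_nb d
    using expander_cube[OF d, of False] by (simp add: even_class_eq odd_class_eq)
  have indep: "indep_sets_cube d = {I. E.indep I}" by (rule indep_sets_cube_eq[OF d])
  have cO: "card (odd_class d) = 2 ^ (d - 1)" using E.card_L E.card_L_eq_card_R by simp
  let ?S = "SIGMA u:even_class d. Pow (odd_class d - cube_nb u)"
  let ?f = "\<lambda>(u, Y). insert u Y"
  have inj: "inj_on ?f ?S"
  proof (rule inj_onI, clarify)
    fix u Y u' Y'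
    assume a: "u \<in> even_class d" "Y \<subseteq> odd_class d - cube_nb u" "u' \<in> even_class d"
      "Y' \<subseteq> odd_class d - cube_nb u'" "insert u Y = insert u' Y'"
    then have nin: "u \<notin> Y'" "u \<notin> Y" "u' \<notin> Y'" using E.disjoint_LR by auto
    have "u \<in> insert u' Y'" using a(5) by blast
    then have "u = u'" using nin(1) by blast
    moreover have "insert u Y - {u} = Y" "insert u' Y' - {u'} = Y'" using nin by simp_all
    ultimately show "u = u' \<and> Y = Y'" using a(5) by metis
  qed
  have img: "?f ` ?S \<subseteq> {I. E.indep I}"
  proof clarify
    fix u Y assume a: "u \<in> even_class d" "Y \<subseteq> odd_class d - cube_nb u"
    have "insert u Y \<inter> even_class d = {u}" using a E.disjoint_LR by auto
    moreover have "cube_nb u \<inter> insert u Y = {}" using a E.nb_L[OF a(1)] E.disjoint_LR by auto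
    ultimately show "E.indep (insert u Y)" using a unfolding E.indep_def by auto
  qed
  have "2 ^ (d - 1) * l * (1 + l) ^ (2 ^ (d - 1) - d) = (\<Sum>u\<in>even_class d. l * (1 + l) ^ (2 ^ (d - 1) - d))"
    by (simp add: E.card_L)
  also have "\<dots> = (\<Sum>u\<in>even_class d. \<Sum>Y\<in>Pow (odd_class d - cube_nb u). l * l ^ card Y)"
  proof (intro sum.cong refl)
    fix u assume u: "u \<in> even_class d"
    have "card (odd_class d - cube_nb u) = 2 ^ (d - 1) - d"
      using E.nb_L[OF u] E.deg_L[OF u] cO E.finite_nb(1)[OF u] by (simp add: card_Diff_subset)
    then show "l * (1 + l) ^ (2 ^ (d - 1) - d) = (\<Sum>Y\<in>Pow (odd_class d - cube_nb u). l * l ^ card Y)"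
      using sum_Pow_power_card[of "odd_class d - cube_nb u" l] E.finite_R by (simp add: sum_distrib_left[symmetric])
  qed
  also have "\<dots> = (\<Sum>(u, Y)\<in>?S. l * l ^ card Y)"
    using E.finite_L E.finite_R by (intro sum.Sigma) auto
  also have "\<dots> = (\<Sum>p\<in>?S. l ^ card (?f p))"
  proof (intro sum.cong refl, clarify)
    fix u Y assume a: "u \<in> even_class d" "Y \<subseteq> odd_class d - cube_nb u"
    have "finite Y" using a(2) E.finite_R by (auto intro: finite_subset)
    moreover have "u \<notin> Y" using a E.disjoint_LR by auto
    ultimately show "l * l ^ card Y = l ^ card (insert u Y)" by simp
  qed
  also have "\<dots> = (\<Sum>I\<in>?f ` ?S. l ^ card I)" by (simp add: sum.reindex[OF inj] o_def)
  also have "\<dots> \<le> (\<Sum>I | E.indep I. l ^ card I)"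
    using img E.finite_indep l by (intro sum_mono2) auto
  finally show ?thesis by (simp add: hc_partition_def indep)
qed

lemma prob_one_sided_le:
  assumes l: "l > 0" and d: "d \<ge> 1" "d \<le> 2 ^ (d - 1)"
  shows "measure_pmf.prob (hc d l) (one_sided d) \<le> 4 * ((1 + l) / 2) ^ d / l"
proof -
  let ?N = "2 ^ (d - 1) :: nat"
  let ?G = "{I. I \<in> indep_sets_cube d \<and> I \<in> one_sided d}"
  have d0: "d > 0" using d by simp
  interpret E: expander "even_class d" "odd_class d" cube_nb d
    using expander_cube[OF d0, of False] by (simp add: even_class_eq odd_class_eq)
  have cO: "card (odd_class d) = ?N" using E.card_L E.card_L_eq_card_R by simp
  have "?G \<subseteq> Pow (even_class d) \<union> Pow (odd_class d)"
    by (auto simp: indep_sets_cube_eq[OF d0] E.indep_def one_sided_iff)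
  then have "(\<Sum>I\<in>?G. l ^ card I) \<le> (\<Sum>I\<in>Pow (even_class d) \<union> Pow (odd_class d). l ^ card I)"
    using E.finite_L E.finite_R l by (intro sum_mono2) auto
  also have "\<dots> \<le> (\<Sum>I\<in>Pow (even_class d). l ^ card I) + (\<Sum>I\<in>Pow (odd_class d). l ^ card I)"
    using sum.union_inter[of "Pow (even_class d)" "Pow (odd_class d)" "\<lambda>I. l ^ card I"]
      sum_nonneg[of "Pow (even_class d) \<inter> Pow (odd_class d)" "\<lambda>I. l ^ card I"] E.finite_L E.finite_R l by simp
  also have "\<dots> = 2 * (1 + l) ^ ?N"
    by (simp add: sum_Pow_power_card E.finite_L E.finite_R E.card_L cO)
  finally have G: "(\<Sum>I\<in>?G. l ^ card I) \<le> 2 * (1 + l) ^ ?N" .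
  let ?D = "real ?N * l * (1 + l) ^ (?N - d)"
  have D: "?D > 0" using l by simp
  have ZD: "?D \<le> hc_partition d l" using hc_partition_ge[OF l d0] by simp
  have "measure_pmf.prob (hc d l) (one_sided d) = (\<Sum>I\<in>?G. l ^ card I) / hc_partition d l"
    by (rule prob_hc[OF l])
  also have "\<dots> \<le> 2 * (1 + l) ^ ?N / ?D"
    using G ZD D l by (intro frac_le) auto
  also have "(1 + l) ^ ?N = (1 + l) ^ d * (1 + l) ^ (?N - d)" using d(2) by (simp flip: power_add)
  also have "2 * ((1 + l) ^ d * (1 + l) ^ (?N - d)) / ?D = 2 * (1 + l) ^ d / (?N * l)"
    using l by (simp add: field_simps)
  also have "\<dots> = 4 * ((1 + l) / 2) ^ d / l"
  proof -
    have "2 * c / (n * l) = 4 * (c / (2 * n)) / l" for c n :: real by simp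
    moreover have "2 * real ?N = 2 ^ d" using d0 by (cases d) simp_all
    ultimately show ?thesis by (simp only: power_divide)
  qed
  finally show ?thesis .
qed

text \<open>For \<open>l < 1/2\<close> the power \<open>(3/4) ^ d\<close> makes up for the factor \<open>1 / l\<close>; this is the only
  use of the lower bound on the fugacity.\<close>
lemma half_power_le:
  fixes l :: real
  assumes l: "l > 0" and d: "d \<ge> 3" and low: "l \<ge> ln d / d powr (1/3)"
  shows "4 * ((1 + l) / 2) ^ d / l \<le> 8 * exp (- (real d * (1 - l)) / 2) + 4 * (3/4) ^ d * d powr (1/3)"
proof (cases "l \<ge> 1 / 2")
  case True
  have "(1 + l) / 2 \<le> exp (- (1 - l) / 2)" using exp_ge_add_one_self[of "- (1 - l) / 2"] by (simp add: field_simps)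
  then have "((1 + l) / 2) ^ d \<le> exp (- (1 - l) / 2) ^ d" using l by (intro power_mono) auto
  also have "\<dots> = exp (- (real d * (1 - l)) / 2)" by (simp flip: exp_of_nat_mult add: algebra_simps)
  finally have *: "((1 + l) / 2) ^ d \<le> exp (- (real d * (1 - l)) / 2)" .
  have "4 * ((1 + l) / 2) ^ d / l \<le> 4 * exp (- (real d * (1 - l)) / 2) / (1 / 2)"
    using * True l by (intro frac_le mult_left_mono) auto
  then show ?thesis by (simp add: add_increasing2)
next
  case False
  have "1 \<le> ln (real d)"
  proof -
    have "exp 1 \<le> real d" using exp_le d by linarith
    then show ?thesis using d by (subst ln_ge_iff) auto
  qed
  then have "1 / d powr (1/3) \<le> ln d / d powr (1/3)" by (intro divide_right_mono) auto
  then have "1 / d powr (1/3) \<le> l" using low by linarith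
  then have "1 / l \<le> d powr (1/3)" using l d by (simp add: field_simps)
  moreover have "((1 + l) / 2) ^ d \<le> (3/4) ^ d" using l False by (intro power_mono) auto
  ultimately have "4 * ((1 + l) / 2) ^ d * (1 / l) \<le> 4 * (3/4) ^ d * d powr (1/3)"
    using l by (intro mult_mono) auto
  then show ?thesis by (simp add: add_increasing)
qed

theorem corollary1p2:
  "\<exists>c0::real. c0 > 0 \<and>
     (\<forall>l::nat \<Rightarrow> real.
        (\<forall>d\<ge>1. l d > 0 \<and> l d \<ge> c0 * ln (real d) / real d powr (1/3)) \<longrightarrow>
          (filterlim (\<lambda>d. real d * (l d - 1)) at_top sequentially \<longrightarrow>
             (\<lambda>d. measure_pmf.prob (hc d (l d))
                {I. min (card (I \<inter> even_class d)) (card (I \<inter> odd_class d)) = 0}) \<longlonglongrightarrow> 1) \<and>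
          (filterlim (\<lambda>d. real d * (1 - l d)) at_top sequentially \<longrightarrow>
             (\<lambda>d. measure_pmf.prob (hc d (l d))
                {I. min (card (I \<inter> even_class d)) (card (I \<inter> odd_class d)) = 0}) \<longlonglongrightarrow> 0))"
  unfolding one_sided_def[symmetric]
  \<comment> \<open>any positive constant would do\<close>
proof (intro exI[of _ 1] conjI allI impI)
  fix l :: "nat \<Rightarrow> real"
  assume "\<forall>d\<ge>1. l d > 0 \<and> l d \<ge> 1 * ln (real d) / real d powr (1/3)"
  then have lpos: "l d > 0" and llow: "l d \<ge> ln (real d) / real d powr (1/3)" if "d \<ge> 1" for d
    using that by auto
  let ?p = "\<lambda>d. measure_pmf.prob (hc d (l d)) (one_sided d)"
  show "?p \<longlonglongrightarrow> 1" if lim: "filterlim (\<lambda>d. real d * (l d - 1)) at_top sequentially"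
  proof (rule tendsto_sandwich)
    show "\<forall>\<^sub>F d in sequentially. 1 - 2 * (1 / (1 + real d * (l d - 1) / 4) + polymer_error d) \<le> ?p d"
      using eventually_large_dim filterlim_at_top_dense[THEN iffD1, OF lim, rule_format, of 0]
    proof eventually_elim
      case (elim d)
      have d: "d \<ge> 2" using elim(1) by (simp add: large_dim_def)
      have l: "l d \<ge> 1" using elim(2) d by (simp add: zero_less_mult_iff)
      have "1 - 2 * (1 / (1 + real d * (l d - 1) / 4) + polymer_error d)
          \<le> 1 - 2 * (2 ^ (d - 1) * l d / (1 + l d) ^ d + polymer_error d)"
        by (intro diff_left_mono mult_left_mono add_right_mono singleton_weight_le l d) simp
      also have "\<dots> \<le> ?p d" by (rule prob_one_sided_ge[OF l elim(1)])
      finally show ?case .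
    qed
    show "\<forall>\<^sub>F d in sequentially. ?p d \<le> 1" by simp
    have "filterlim (\<lambda>d. real d * (l d - 1) * (1/4)) at_top sequentially"
      by (rule filterlim_at_top_mult_tendsto_pos[where c = "1/4", OF tendsto_const _ lim]) simp
    then have "filterlim (\<lambda>d. 1 + real d * (l d - 1) / 4) at_top sequentially"
      by (intro filterlim_tendsto_add_at_top[OF tendsto_const]) simp
    then have "(\<lambda>d. 1 / (1 + real d * (l d - 1) / 4)) \<longlonglongrightarrow> 0"
      by (intro tendsto_divide_0[OF tendsto_const] filterlim_at_top_imp_at_infinity)
    then have "(\<lambda>d. 1 - 2 * (1 / (1 + real d * (l d - 1) / 4) + polymer_error d)) \<longlonglongrightarrow> 1 - 2 * (0 + 0)"
      by (intro tendsto_intros polymer_error_tendsto)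
    then show "(\<lambda>d. 1 - 2 * (1 / (1 + real d * (l d - 1) / 4) + polymer_error d)) \<longlonglongrightarrow> 1" by simp
  qed simp
  show "?p \<longlonglongrightarrow> 0" if lim: "filterlim (\<lambda>d. real d * (1 - l d)) at_top sequentially"
  proof (rule tendsto_sandwich)
    show "\<forall>\<^sub>F d in sequentially. 0 \<le> ?p d" by simp
    have "eventually (\<lambda>d::nat. real d \<le> 2 ^ (d - 1)) sequentially" by real_asymp
    then show "\<forall>\<^sub>F d in sequentially. ?p d \<le>
        8 * exp (- (real d * (1 - l d)) / 2) + 4 * (3/4) ^ d * d powr (1/3)"
      using eventually_ge_at_top[of 3]
    proof eventually_elim
      case (elim d)
      then have d: "d \<ge> 1" "d \<le> 2 ^ (d - 1)"
        using of_nat_le_iff[of d "2 ^ (d - 1)", where ?'a = real] by auto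
      show ?case
        using prob_one_sided_le[OF lpos[OF d(1)] d] half_power_le[OF lpos[OF d(1)] elim(2) llow[OF d(1)]]
        by (rule order_trans)
    qed
    have "filterlim (\<lambda>d. real d * (1 - l d) * (1/2)) at_top sequentially"
      by (rule filterlim_at_top_mult_tendsto_pos[where c = "1/2", OF tendsto_const _ lim]) simp
    then have "filterlim (\<lambda>d. - (real d * (1 - l d)) / 2) at_bot sequentially"
      by (simp add: filterlim_uminus_at_bot)
    then have "(\<lambda>d. exp (- (real d * (1 - l d)) / 2)) \<longlonglongrightarrow> 0"
      by (rule filterlim_compose[OF exp_at_bot])
    moreover have "(\<lambda>d::nat. 4 * (3/4) ^ d * d powr (1/3)) \<longlonglongrightarrow> 0" by real_asymp
    ultimately have "(\<lambda>d. 8 * exp (- (real d * (1 - l d)) / 2) + 4 * (3/4) ^ d * d powr (1/3)) \<longlonglongrightarrow> 8 * 0 + 0"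
      by (intro tendsto_intros)
    then show "(\<lambda>d. 8 * exp (- (real d * (1 - l d)) / 2) + 4 * (3/4) ^ d * d powr (1/3)) \<longlonglongrightarrow> 0" by simp
  qed simp
qed simp

end
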